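(* The variance of the external profile $B_{n,k}$ of a random symmetric digital search tree of size $n$ satisfies \[ \mathrm{Var}(B_{n,k}) = 2^kG(2^{-k}n)+\mathcal{O}(1), \] uniformly for $0\le k\le n$, where $G(x)$ is a positive function on $\mathbb{R}^+=(0,\infty)$ defined by \[ G(x)=\sum_{j,r\ge0}\ \sum_{0\le h,\ell\le j}\frac{(-1)^{r+h+\ell}\,2^{-j-\binom r2-\binom h2-\binom \ell2+2h+2\ell}}{Q_\infty Q_rQ_hQ_{j-h}Q_\ell Q_{j-\ell}}\,\varphi(2^{j+r},2^h+2^\ell;x), \] with \[ \varphi(u,v;x)=e^{-vx}\int_0^x(x-t)e^{-(u-v)t}\,\mathrm{d}t=\begin{cases}\displaystyle e^{-vx}\,\frac{e^{-(u-v)x}-1+(u-v)x}{(u-v)^2},&u\ne v;\\[4pt] \tfrac12x^2e^{-ux},&u=v.\end{cases} \]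
   Context: Notation: $Q_n=\prod_{1\le \ell\le n}(1-2^{-\ell})$ (so $Q_0=1$) and $Q_\infty=\prod_{\ell\ge1}(1-2^{-\ell})$. Random symmetric digital search tree (DST) of size $n$: one is given a sequence of $n$ records, each an infinite string of bits, all bits of all records being independent and uniform on $\{0,1\}$. If $n=0$ the tree is a single external node. If $n\ge1$, the first record is stored in the root (an internal node, at level $0$); the remaining $n-1$ records are distributed, retaining their relative order, to the left or right subtree according as their first bit is $0$ or $1$; the subtrees are built recursively by the same rule, using the next bit at each level. Thus the tree is a binary tree with $n$ internal nodes (holding the records) and $n+1$ external nodes (empty places). External profile: $B_{n,k}$ is the number of external nodes at level (distance from the root) $k$. Equivalently, $B_{0,0}=1$, $B_{0,k}=0$ for $k\ge1$, $B_{n,0}=0$ for $n\ge1$, and for $n,k\ge1$, $B_{n,k}\stackrel{d}{=}B_{J_n,k-1}+B^*_{n-1-J_n,k-1}$, where $J_n$ is Binomial$(n-1,\frac12)$, and $B^*$ is an independent copy of $B$ (both independent of $J_n$). *)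

theory Defs
  imports "HOL-Probability.Probability" "HOL-Library.Tree"
begin

text \<open>
  Records are infinite bit strings, i.e. Boolean streams (\<open>False\<close> is the bit \<open>0\<close>).
  In the trees, \<open>Leaf\<close> is an external node and \<open>Node\<close> an internal node holding a record.
  The first argument of \<open>dst\<close> is the level of the root, hence the index of the bit
  that governs the branching there.
\<close>

function dst :: "nat \<Rightarrow> bool stream list \<Rightarrow> bool stream tree" where
  "dst d [] = Leaf"
| "dst d (s # ss) =
     Node (dst (Suc d) (filter (\<lambda>t. \<not> t !! d) ss)) s (dst (Suc d) (filter (\<lambda>t. t !! d) ss))"
  by pat_completeness auto
termination
  by (relation "Wellfounded.measure (\<lambda>(d, ss). length ss)") (auto simp: le_imp_less_Suc)

fun external_nodes_at :: "'a tree \<Rightarrow> nat \<Rightarrow> nat" where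
  "external_nodes_at Leaf k = (if k = 0 then 1 else 0)"
| "external_nodes_at (Node l a r) 0 = 0"
| "external_nodes_at (Node l a r) (Suc k) = external_nodes_at l k + external_nodes_at r k"

definition random_record :: "bool stream measure" where
  "random_record = stream_space (measure_pmf (bernoulli_pmf (1 / 2)))"

definition random_records :: "nat \<Rightarrow> (nat \<Rightarrow> bool stream) measure" where
  "random_records n = PiM {..<n} (\<lambda>_. random_record)"

definition external_profile :: "nat \<Rightarrow> nat \<Rightarrow> (nat \<Rightarrow> bool stream) \<Rightarrow> nat" where
  "external_profile n k \<omega> = external_nodes_at (dst 0 (map \<omega> [0..<n])) k"

definition Q :: "nat \<Rightarrow> real" where
  "Q n = (\<Prod>l=1..n. 1 - (1 / 2) ^ l)"

definition Q_inf :: real where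
  "Q_inf = (\<Prod>l. 1 - (1 / 2) ^ Suc l)"

definition phi :: "real \<Rightarrow> real \<Rightarrow> real \<Rightarrow> real" where
  "phi u v x = exp (- (v * x)) * integral {0..x} (\<lambda>t. (x - t) * exp (- ((u - v) * t)))"

definition G_term :: "nat \<Rightarrow> nat \<Rightarrow> nat \<Rightarrow> nat \<Rightarrow> real \<Rightarrow> real" where
  "G_term j r h l x =
     (- 1) ^ (r + h + l)
     * 2 powi (- int j - int (r choose 2) - int (h choose 2) - int (l choose 2)
               + 2 * int h + 2 * int l)
     / (Q_inf * Q r * Q h * Q (j - h) * Q l * Q (j - l))
     * phi (2 ^ (j + r)) (2 ^ h + 2 ^ l) x"

text \<open>
  The double series over \<open>j, r\<close> is an unordered (absolutely convergent) sum. Its value would be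
  \<open>0\<close> if it did not converge, so \<open>G x > 0\<close> entails convergence at \<open>x\<close>.
\<close>

definition G :: "real \<Rightarrow> real" where
  "G x = (\<Sum>\<^sub>\<infinity>(j, r)\<in>UNIV. \<Sum>h=0..j. \<Sum>l=0..j. G_term j r h l x)"

lemma prob_space_random_records: "prob_space (random_records n)"
  unfolding random_records_def random_record_def
  by (intro prob_space_PiM prob_space.prob_space_stream_space prob_space_measure_pmf)

lemma phi_neq:
  assumes "u \<noteq> v" "0 \<le> x"
  shows "phi u v x = exp (- (v * x)) * ((exp (- ((u - v) * x)) - 1 + (u - v) * x) / (u - v)\<^sup>2)"
proof -
  define w where "w = u - v"
  define F where "F t = - ((x - t) * exp (- (w * t)) / w) + exp (- (w * t)) / w\<^sup>2" for t
  have w: "w \<noteq> 0" using assms by (simp add: w_def)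
  have "((\<lambda>t. (x - t) * exp (- (w * t))) has_integral (F x - F 0)) {0..x}"
  proof (rule fundamental_theorem_of_calculus)
    show "0 \<le> x" by fact
    fix t
    have "(F has_real_derivative (x - t) * exp (- (w * t))) (at t within {0..x})"
      unfolding F_def using w
      by (auto intro!: derivative_eq_intros simp: field_simps power2_eq_square)
    then show "(F has_vector_derivative (x - t) * exp (- (w * t))) (at t within {0..x})"
      by (simp add: has_real_derivative_iff_has_vector_derivative)
  qed
  moreover have "F x - F 0 = (exp (- (w * x)) - 1 + w * x) / w\<^sup>2"
    using w by (simp add: F_def field_simps power2_eq_square)
  ultimately have "integral {0..x} (\<lambda>t. (x - t) * exp (- (w * t))) = (exp (- (w * x)) - 1 + w * x) / w\<^sup>2"
    by (simp add: integral_unique)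
  then show ?thesis by (simp add: phi_def w_def)
qed

lemma phi_eq:
  assumes "0 \<le> x"
  shows "phi u u x = x\<^sup>2 / 2 * exp (- (u * x))"
proof -
  have "((\<lambda>t. x - t) has_integral ((x * x - x\<^sup>2 / 2) - (x * 0 - 0\<^sup>2 / 2))) {0..x}"
    by (rule fundamental_theorem_of_calculus)
      (auto intro!: derivative_eq_intros assms
        simp flip: has_real_derivative_iff_has_vector_derivative)
  then show ?thesis
    by (simp add: phi_def integral_unique power2_eq_square)
qed

end

theory Submission
  imports Defs
begin

text \<open>
  The level-\<open>k\<close> profile depends on the first \<open>k\<close> bits of the records only, so its first two moments
  are averages over finite bit matrices. Sorting the rows by their first bit turns the recursive
  construction of the tree into recurrences in \<open>k\<close> and \<open>n\<close> for the mean and the second moment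
  (\<open>mean_Suc_Suc\<close>, \<open>second_moment_Suc_Suc\<close>).

  These recurrences are solved exactly. Binomial thinning maps \<open>(1 - a) ^ i\<close> to \<open>(1 - a / 2) ^ n\<close>,
  hence the mean is a combination of the powers \<open>(1 - 2 ^ h / 2 ^ k) ^ n\<close> (\<open>mean_eq\<close>). The second
  moment (\<open>second_moment_eq\<close>) has two parts. One is a double sum of terms \<open>pair_moment n a b\<close>, which
  imitate \<open>((1 - a) * (1 - b)) ^ n\<close> to first order in \<open>a * b\<close> and so nearly cancel against the squared
  mean. The other is a truncated version of the series \<open>G\<close>, with the kernel \<open>phi\<close> replaced by the
  discrete convolution \<open>phi_discrete\<close>. It is this exact form that makes bounded errors attainable by
  estimating every term separately, although mean and second moment are of the orders
  \<open>2 ^ k\<close> and \<open>4 ^ k\<close>.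

  Three errors have to be bounded. Passing from \<open>phi_discrete\<close> to \<open>phi\<close> costs a multiple of
  \<open>1 / u + 1 / v\<close> (\<open>phi_discrete_error\<close>), because both kernels satisfy contracting recursions with
  nearly the same coefficients; the arguments are at least \<open>2 ^ - k\<close> and the sum carries a factor
  \<open>2 ^ - k\<close>. On the top level \<open>1 - v\<close> can be negative and this estimate fails, but whenever that happens
  the terms of \<open>phi_discrete\<close> and of \<open>pair_moment\<close> cancel exactly (\<open>top_level_error\<close>). Finally, the truncated
  series differs from \<open>G\<close> by a multiple of \<open>2 ^ - k\<close> only (\<open>kernel_sum_phi_error\<close>), since the products
  \<open>Q m\<close> approach \<open>Q_inf\<close> geometrically and the coefficients decay like \<open>2 ^ - (r choose 2)\<close>.

  For positivity, the signed sums with coefficients \<open>coef m\<close> are densities of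
  \<open>E\<^sub>0 + E\<^sub>1 / 2 + \<dots> + E\<^sub>m / 2 ^ m\<close> with independent exponential variables, and \<open>phi\<close> is a
  convolution. So each truncated sum is a sum of integrals of nonnegative functions
  (\<open>kernel_level_integral\<close>). The first of them stays away from zero because the densities do, uniformly
  in \<open>m\<close> (\<open>tilted_hypoexp_eventually_pos\<close>); hence so does the limit \<open>G x\<close>.
\<close>

section \<open>Reduction to averages over finite bit matrices\<close>

text \<open>
  The profile at level \<open>k\<close> depends on the first \<open>k\<close> bits of each record only. Counting on lists of
  finite bit rows, whose leading bit is removed at each branching, makes every level look like
  level \<open>0\<close>, so that one recursion serves all levels.
\<close>

fun external_count :: "nat \<Rightarrow> bool list list \<Rightarrow> nat" where
  "external_count 0 rs = (if rs = [] then 1 else 0)"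
| "external_count (Suc k) [] = 0"
| "external_count (Suc k) (r # rs) =
     external_count k (map tl (filter (\<lambda>r. \<not> hd r) rs)) + external_count k (map tl (filter hd rs))"

lemma external_nodes_at_dst:
  "external_nodes_at (dst d ss) k = external_count k (map (\<lambda>s. stake k (sdrop d s)) ss)"
proof (induction k arbitrary: d ss)
  case 0
  show ?case by (cases ss) auto
next
  case (Suc k)
  show ?case
  proof (cases ss)
    case Nil
    then show ?thesis by simp
  next
    case (Cons s ts)
    have tl_stake: "tl (stake (Suc k) (sdrop d t)) = stake k (sdrop (Suc d) t)" for t :: "bool stream"
      by (simp add: sdrop_simps del: sdrop.simps)
    have hd_stake: "hd (stake (Suc k) (sdrop d t)) = t !! d" for t :: "bool stream"
      by (simp add: sdrop_simps)
    show ?thesis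
      unfolding Cons dst.simps external_nodes_at.simps list.map external_count.simps Suc.IH
      by (simp only: filter_map map_map comp_def tl_stake hd_stake)
  qed
qed

text \<open>
  The distribution of the first \<open>k\<close> bits of \<open>n\<close> records is uniform on bit matrices, so expectations
  become iterated averages. \<open>row_avg\<close> averages over one row and \<open>rows_avg\<close> over an ordered list of
  rows. In \<open>split_avg\<close> the two arguments of \<open>f\<close> are the sizes of the two subtrees, hence a
  binomial variable with parameters \<open>n\<close>, \<open>1/2\<close> and its complement.
\<close>

primrec row_avg :: "nat \<Rightarrow> (bool list \<Rightarrow> real) \<Rightarrow> real" where
  "row_avg 0 f = f []"
| "row_avg (Suc k) f = (row_avg k (\<lambda>r. f (False # r)) + row_avg k (\<lambda>r. f (True # r))) / 2"

primrec rows_avg :: "nat \<Rightarrow> nat \<Rightarrow> (bool list list \<Rightarrow> real) \<Rightarrow> real" where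
  "rows_avg k 0 f = f []"
| "rows_avg k (Suc n) f = row_avg k (\<lambda>r. rows_avg k n (\<lambda>rs. f (r # rs)))"

primrec split_avg :: "nat \<Rightarrow> (nat \<Rightarrow> nat \<Rightarrow> real) \<Rightarrow> real" where
  "split_avg 0 f = f 0 0"
| "split_avg (Suc n) f = (split_avg n (\<lambda>i j. f (Suc i) j) + split_avg n (\<lambda>i j. f i (Suc j))) / 2"

lemma row_avg_const [simp]: "row_avg k (\<lambda>_. a) = a"
  by (induction k) auto

lemma row_avg_nonneg: "(\<And>r. 0 \<le> f r) \<Longrightarrow> 0 \<le> row_avg k f"
  by (induction k arbitrary: f) auto

lemma rows_avg_nonneg: "(\<And>rs. 0 \<le> f rs) \<Longrightarrow> 0 \<le> rows_avg k n f"
  by (induction n arbitrary: f) (auto intro: row_avg_nonneg)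

lemma row_avg_add: "row_avg k (\<lambda>r. f r + g r) = row_avg k f + row_avg k g"
  by (induction k arbitrary: f g) (auto simp: add_divide_distrib)

lemma row_avg_cmult: "row_avg k (\<lambda>r. a * f r) = a * row_avg k f"
  by (induction k arbitrary: f) (auto simp: algebra_simps add_divide_distrib)

lemma rows_avg_add: "rows_avg k n (\<lambda>r. f r + g r) = rows_avg k n f + rows_avg k n g"
  by (induction n arbitrary: f g) (auto simp: row_avg_add)

lemma rows_avg_cmult: "rows_avg k n (\<lambda>r. a * f r) = a * rows_avg k n f"
  by (induction n arbitrary: f) (auto simp: row_avg_cmult)

lemma rows_avg_const [simp]: "rows_avg k n (\<lambda>_. a) = a"
  by (induction n) auto

lemma split_avg_add: "split_avg n (\<lambda>i j. f i j + g i j) = split_avg n f + split_avg n g"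
  by (induction n arbitrary: f g) (auto simp: add_divide_distrib)

lemma split_avg_cmult: "split_avg n (\<lambda>i j. a * f i j) = a * split_avg n f"
  by (induction n arbitrary: f) (auto simp: algebra_simps add_divide_distrib)

lemma split_avg_sum: "split_avg n (\<lambda>i j. \<Sum>x\<in>A. f x i j) = (\<Sum>x\<in>A. split_avg n (f x))"
  by (induction n arbitrary: f) (auto simp: sum.distrib simp flip: sum_divide_distrib)

lemma split_avg_swap: "split_avg n (\<lambda>i j. f j i) = split_avg n f"
proof (induction n arbitrary: f)
  case (Suc n)
  show ?case
    using Suc.IH[of "\<lambda>i j. f i (Suc j)"] Suc.IH[of "\<lambda>i j. f (Suc i) j"] by simp
qed simp

lemma row_avg_split_avg:
  "row_avg k (\<lambda>r. split_avg n (f r)) = split_avg n (\<lambda>i j. row_avg k (\<lambda>r. f r i j))"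
proof (induction n arbitrary: f)
  case (Suc n)
  have "row_avg k (\<lambda>r. split_avg (Suc n) (f r))
      = row_avg k (\<lambda>r. (1/2) * (split_avg n (\<lambda>i j. f r (Suc i) j) + split_avg n (\<lambda>i j. f r i (Suc j))))"
    by simp
  also have "\<dots> = split_avg (Suc n) (\<lambda>i j. row_avg k (\<lambda>r. f r i j))"
    by (simp only: row_avg_cmult row_avg_add Suc.IH) simp
  finally show ?case .
qed simp

lemma row_avg_swap:
  "row_avg k (\<lambda>r. row_avg l (f r)) = row_avg l (\<lambda>s. row_avg k (\<lambda>r. f r s))"
proof (induction l arbitrary: f)
  case (Suc l)
  have "row_avg k (\<lambda>r. row_avg (Suc l) (f r))
      = row_avg k (\<lambda>r. (1/2) * (row_avg l (\<lambda>s. f r (False # s)) + row_avg l (\<lambda>s. f r (True # s))))"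
    by simp
  also have "\<dots> = row_avg (Suc l) (\<lambda>s. row_avg k (\<lambda>r. f r s))"
    by (simp only: row_avg_cmult row_avg_add Suc.IH) simp
  finally show ?case .
qed simp

lemma row_avg_rows_avg_swap:
  "row_avg k (\<lambda>r. rows_avg l n (f r)) = rows_avg l n (\<lambda>rs. row_avg k (\<lambda>r. f r rs))"
proof (induction n arbitrary: f)
  case (Suc n)
  show ?case
    unfolding rows_avg.simps by (subst row_avg_swap) (simp only: Suc.IH)
qed simp

text \<open>
  Independence of the subtrees given their sizes: sorting the rows by their first bit leaves two
  independent uniform matrices. The proof inserts one row at a time, its first bit deciding which
  of the two lists it extends, and then exchanges finite averages.
\<close>

lemma rows_avg_split:
  "rows_avg (Suc k) n (\<lambda>rs. f (map tl (filter (\<lambda>r. \<not> hd r) rs)) (map tl (filter hd rs)))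
   = split_avg n (\<lambda>i j. rows_avg k i (\<lambda>rs. rows_avg k j (\<lambda>ts. f rs ts)))"
proof (induction n arbitrary: f)
  case (Suc n)
  have 1: "rows_avg (Suc k) n (\<lambda>rs. f (r # map tl (filter (\<lambda>r. \<not> hd r) rs)) (map tl (filter hd rs)))
      = split_avg n (\<lambda>i j. rows_avg k i (\<lambda>rs. rows_avg k j (\<lambda>ts. f (r # rs) ts)))" for r
    by (rule Suc.IH)
  have 2: "rows_avg (Suc k) n (\<lambda>rs. f (map tl (filter (\<lambda>r. \<not> hd r) rs)) (r # map tl (filter hd rs)))
      = split_avg n (\<lambda>i j. rows_avg k i (\<lambda>rs. rows_avg k j (\<lambda>ts. f rs (r # ts))))" for r
    by (rule Suc.IH)
  have "rows_avg (Suc k) (Suc n) (\<lambda>rs. f (map tl (filter (\<lambda>r. \<not> hd r) rs)) (map tl (filter hd rs)))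
      = (row_avg k (\<lambda>r. rows_avg (Suc k) n
            (\<lambda>rs. f (r # map tl (filter (\<lambda>r. \<not> hd r) rs)) (map tl (filter hd rs))))
         + row_avg k (\<lambda>r. rows_avg (Suc k) n
            (\<lambda>rs. f (map tl (filter (\<lambda>r. \<not> hd r) rs)) (r # map tl (filter hd rs))))) / 2"
    unfolding rows_avg.simps row_avg.simps by simp
  also have "\<dots> = split_avg (Suc n) (\<lambda>i j. rows_avg k i (\<lambda>rs. rows_avg k j (\<lambda>ts. f rs ts)))"
    unfolding 1 2 row_avg_split_avg split_avg.simps rows_avg.simps
    by (simp only: row_avg_rows_avg_swap)
  finally show ?case .
qed simp

text \<open>
  Product measures grow by a new last coordinate, whereas \<open>rows_avg\<close> prepends rows;
  this identity reconciles the two.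
\<close>

lemma rows_avg_snoc:
  "rows_avg k (Suc n) f = rows_avg k n (\<lambda>rs. row_avg k (\<lambda>r. f (rs @ [r])))"
proof (induction n arbitrary: f)
  case (Suc n)
  have "rows_avg k (Suc (Suc n)) f = row_avg k (\<lambda>r. rows_avg k (Suc n) (\<lambda>rs. f (r # rs)))"
    by (simp only: rows_avg.simps)
  also have "\<dots> = row_avg k (\<lambda>r. rows_avg k n (\<lambda>rs. row_avg k (\<lambda>s. f (r # rs @ [s]))))"
    by (subst Suc.IH) simp
  finally show ?case by simp
qed simp

definition mean :: "nat \<Rightarrow> nat \<Rightarrow> real" where
  "mean k n = rows_avg k n (\<lambda>rs. real (external_count k rs))"

definition second_moment :: "nat \<Rightarrow> nat \<Rightarrow> real" where
  "second_moment k n = rows_avg k n (\<lambda>rs. (real (external_count k rs))\<^sup>2)"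

lemma mean_0: "mean 0 n = 0 ^ n"
  by (cases n) (simp_all add: mean_def)

lemma mean_Suc_0: "mean (Suc k) 0 = 0"
  by (simp add: mean_def)

lemma mean_Suc_Suc:
  "mean (Suc k) (Suc n) = split_avg n (\<lambda>i j. mean k i + mean k j)"
proof -
  have "mean (Suc k) (Suc n) = rows_avg (Suc k) n (\<lambda>rs.
      real (external_count k (map tl (filter (\<lambda>r. \<not> hd r) rs))) + real (external_count k (map tl (filter hd rs))))"
    by (simp add: mean_def)
  also have "\<dots> = split_avg n (\<lambda>i j. mean k i + mean k j)"
    by (subst rows_avg_split) (simp add: rows_avg_add mean_def)
  finally show ?thesis .
qed

lemma second_moment_0: "second_moment 0 n = 0 ^ n"
  by (cases n) (simp_all add: second_moment_def)

lemma second_moment_Suc_0: "second_moment (Suc k) 0 = 0"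
  by (simp add: second_moment_def)

text \<open>
  The mixed term factors because the two subtrees are independent given their sizes.
\<close>

lemma second_moment_Suc_Suc:
  "second_moment (Suc k) (Suc n)
   = split_avg n (\<lambda>i j. second_moment k i + second_moment k j + 2 * (mean k i * mean k j))"
proof -
  have "second_moment (Suc k) (Suc n) = rows_avg (Suc k) n (\<lambda>rs.
      (real (external_count k (map tl (filter (\<lambda>r. \<not> hd r) rs)))
        + real (external_count k (map tl (filter hd rs))))\<^sup>2)"
    by (simp add: second_moment_def)
  also have "\<dots> = split_avg n (\<lambda>i j. rows_avg k i (\<lambda>rs. rows_avg k j (\<lambda>ts.
      (real (external_count k rs) + real (external_count k ts))\<^sup>2)))"
    by (rule rows_avg_split)
  also have "\<dots> = split_avg n (\<lambda>i j. second_moment k i + second_moment k j + 2 * (mean k i * mean k j))"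
  proof -
    have "rows_avg k i (\<lambda>rs. rows_avg k j (\<lambda>ts.
        (real (external_count k rs) + real (external_count k ts))\<^sup>2))
      = second_moment k i + second_moment k j + 2 * (mean k i * mean k j)" for i j
    proof -
      have eq: "(real (external_count k rs) + real (external_count k ts))\<^sup>2
          = (real (external_count k rs))\<^sup>2
            + ((real (external_count k ts))\<^sup>2 + (2 * real (external_count k rs)) * real (external_count k ts))" for rs ts
        by (simp add: power2_sum)
      have eq': "(2 * real (external_count k rs)) * m = (2 * m) * real (external_count k rs)" for rs m
        by simp
      show ?thesis
        unfolding eq rows_avg_add rows_avg_cmult rows_avg_const
        unfolding eq' rows_avg_cmult
        by (simp add: mean_def second_moment_def)
    qed
    then show ?thesis by simp
  qed
  finally show ?thesis .
qed

section \<open>The moments of the profile as finite averages\<close>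

lemma measurable_stake_record [measurable]:
  "stake k \<in> random_record \<rightarrow>\<^sub>M count_space UNIV"
proof -
  have "sets random_record = sets (stream_space (count_space UNIV))"
    unfolding random_record_def by (rule sets_stream_space_cong) simp
  then show ?thesis
    using measurable_stake measurable_cong_sets by blast
qed

lemma measurable_stake_records:
  assumes "{..<n} \<subseteq> I"
  shows "(\<lambda>\<omega>. map (\<lambda>i. stake k (\<omega> i)) [0..<n])
     \<in> PiM I (\<lambda>_. random_record) \<rightarrow>\<^sub>M count_space UNIV"
  using assms
proof (induction n)
  case (Suc n)
  have "{..<n} \<subseteq> I" using Suc.prems by (simp add: lessThan_Suc)
  then have [measurable]: "(\<lambda>\<omega>. map (\<lambda>i. stake k (\<omega> i)) [0..<n])
     \<in> PiM I (\<lambda>_. random_record) \<rightarrow>\<^sub>M count_space UNIV"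
    by (rule Suc.IH)
  have "n \<in> I" using Suc.prems by auto
  then have [measurable]: "(\<lambda>\<omega>. stake k (\<omega> n)) \<in> PiM I (\<lambda>_. random_record) \<rightarrow>\<^sub>M count_space UNIV"
    by measurable
  have "(\<lambda>\<omega>. map (\<lambda>i. stake k (\<omega> i)) [0..<n] @ [stake k (\<omega> n)])
     \<in> PiM I (\<lambda>_. random_record) \<rightarrow>\<^sub>M count_space UNIV"
    by measurable
  then show ?case by simp
qed simp

text \<open>
  Nonnegative integrals suffice here, as the profile and its square are nonnegative; the iterated
  integrals then need no integrability side conditions.
\<close>

lemma nn_integral_random_record:
  assumes "\<And>r. 0 \<le> f r"
  shows "(\<integral>\<^sup>+s. ennreal (f (stake k s)) \<partial>random_record) = ennreal (row_avg k f)"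
  using assms
proof (induction k arbitrary: f)
  case 0
  interpret prob_space random_record
    unfolding random_record_def by (intro prob_space.prob_space_stream_space prob_space_measure_pmf)
  show ?case by (simp add: emeasure_space_1)
next
  case (Suc k)
  have "(\<integral>\<^sup>+s. ennreal (f (stake (Suc k) s)) \<partial>random_record)
      = (\<integral>\<^sup>+b. (\<integral>\<^sup>+s. ennreal (f (stake (Suc k) (b ## s))) \<partial>random_record) \<partial>bernoulli_pmf (1/2))"
    unfolding random_record_def
    by (rule prob_space.nn_integral_stream_space[OF prob_space_measure_pmf])
      (use measurable_stake_record[of "Suc k"] in \<open>simp add: random_record_def del: stake.simps\<close>)
  also have "\<dots> = (\<integral>\<^sup>+b. ennreal (row_avg k (\<lambda>r. f (b # r))) \<partial>bernoulli_pmf (1/2))"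
    using Suc.IH[of "\<lambda>r. f (_ # r)"] Suc.prems by simp
  also have "\<dots> = ennreal (row_avg (Suc k) f)"
  proof -
    have *: "0 \<le> row_avg k (\<lambda>r. f (b # r))" for b
      by (rule row_avg_nonneg) (rule Suc.prems)
    show ?thesis
      using *[of True] *[of False]
      by (simp add: add_divide_distrib divide_ennreal_def[symmetric] ennreal_divide_numeral)
  qed
  finally show ?case .
qed

lemma nn_integral_random_records:
  assumes "\<And>rs. 0 \<le> f rs"
  shows "(\<integral>\<^sup>+\<omega>. ennreal (f (map (\<lambda>i. stake k (\<omega> i)) [0..<n])) \<partial>random_records n)
     = ennreal (rows_avg k n f)"
  using assms
proof (induction n arbitrary: f)
  case 0
  interpret prob_space "random_records 0" by (rule prob_space_random_records)
  show ?case by (simp add: emeasure_space_1)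
next
  case (Suc n)
  interpret R: prob_space random_record
    unfolding random_record_def by (intro prob_space.prob_space_stream_space prob_space_measure_pmf)
  interpret product_sigma_finite "\<lambda>_::nat. random_record"
    by unfold_locales
  let ?g = "\<lambda>\<omega>. ennreal (f (map (\<lambda>i. stake k (\<omega> i)) [0..<Suc n]))"
  have meas: "?g \<in> borel_measurable (PiM (insert n {..<n}) (\<lambda>_. random_record))"
    by (rule measurable_compose[OF measurable_stake_records]) auto
  have "(\<integral>\<^sup>+\<omega>. ?g \<omega> \<partial>random_records (Suc n))
     = (\<integral>\<^sup>+\<omega>. (\<integral>\<^sup>+s. ?g (\<omega> (n := s)) \<partial>random_record) \<partial>random_records n)"
    unfolding random_records_def lessThan_Suc
    by (rule product_nn_integral_insert) (use meas in auto)
  also have "\<dots> = (\<integral>\<^sup>+\<omega>. (\<integral>\<^sup>+s. ennreal (f (map (\<lambda>i. stake k (\<omega> i)) [0..<n] @ [stake k s])) \<partial>random_record) \<partial>random_records n)"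
  proof -
    have "map (\<lambda>i. stake k (fun_upd \<omega> n s i)) [0..<Suc n] = map (\<lambda>i. stake k (\<omega> i)) [0..<n] @ [stake k s]"
      for \<omega> :: "nat \<Rightarrow> bool stream" and s by simp
    then show ?thesis by (simp only:)
  qed
  also have "\<dots> = (\<integral>\<^sup>+\<omega>. ennreal (row_avg k (\<lambda>r. f (map (\<lambda>i. stake k (\<omega> i)) [0..<n] @ [r]))) \<partial>random_records n)"
    using Suc.prems by (subst nn_integral_random_record) auto
  also have "\<dots> = ennreal (rows_avg k n (\<lambda>rs. row_avg k (\<lambda>r. f (rs @ [r]))))"
    using Suc.prems by (intro Suc.IH) (auto intro: row_avg_nonneg)
  finally show ?case by (simp only: rows_avg_snoc)
qed

lemma integral_random_records:
  assumes "\<And>rs. 0 \<le> f rs"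
  shows "integrable (random_records n) (\<lambda>\<omega>. f (map (\<lambda>i. stake k (\<omega> i)) [0..<n]))"
    and "(\<integral>\<omega>. f (map (\<lambda>i. stake k (\<omega> i)) [0..<n]) \<partial>random_records n) = rows_avg k n f"
proof -
  let ?g = "\<lambda>\<omega>. f (map (\<lambda>i. stake k (\<omega> i)) [0..<n])"
  have meas: "?g \<in> borel_measurable (random_records n)"
    unfolding random_records_def
    by (rule measurable_compose[OF measurable_stake_records]) auto
  note nn = nn_integral_random_records[of f, OF assms, of n k]
  show int: "integrable (random_records n) ?g"
    by (rule integrableI_nonneg) (use meas assms nn in auto)
  show "integral\<^sup>L (random_records n) ?g = rows_avg k n f"
    using nn_integral_eq_integral[OF int] assms nn
    by (simp add: rows_avg_nonneg)
qed

lemma variance_external_profile: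
  "prob_space.variance (random_records n) (\<lambda>\<omega>. real (external_profile n k \<omega>))
   = second_moment k n - (mean k n)\<^sup>2"
proof -
  interpret prob_space "random_records n" by (rule prob_space_random_records)
  have profile: "external_profile n k \<omega> = external_count k (map (\<lambda>i. stake k (\<omega> i)) [0..<n])" for \<omega>
    by (simp add: external_profile_def external_nodes_at_dst comp_def)
  have 1: "integrable (random_records n) (\<lambda>\<omega>. real (external_profile n k \<omega>))"
    and 2: "expectation (\<lambda>\<omega>. real (external_profile n k \<omega>)) = mean k n"
    unfolding profile mean_def
    by (rule integral_random_records[of "\<lambda>rs. real (external_count k rs)"]; simp)+
  have 3: "integrable (random_records n) (\<lambda>\<omega>. (real (external_profile n k \<omega>))\<^sup>2)"
    and 4: "expectation (\<lambda>\<omega>. (real (external_profile n k \<omega>))\<^sup>2) = second_moment k n"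
    unfolding profile second_moment_def
    by (rule integral_random_records[of "\<lambda>rs. (real (external_count k rs))\<^sup>2"]; simp)+
  show ?thesis
    using variance_eq[OF 1 3] 2 4 by simp
qed

section \<open>Exact formulas for the first two moments\<close>

lemma Q_0 [simp]: "Q 0 = 1"
  by (simp add: Q_def)

lemma Q_Suc: "Q (Suc n) = Q n * (1 - (1 / 2) ^ Suc n)"
  by (simp add: Q_def prod.cl_ivl_Suc mult.commute del: power_Suc)

lemma Q_pos: "0 < Q n"
  unfolding Q_def by (intro prod_pos) (auto simp: power_less_one_iff)

text \<open>
  Partial fractions: \<open>\<Sum>r\<le>m. coef m r * exp (- (2 ^ r * y))\<close> is the density of
  \<open>E\<^sub>0 + E\<^sub>1 / 2 + \<dots> + E\<^sub>m / 2 ^ m\<close> for independent standard exponential variables. Removing the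
  summand \<open>E\<^sub>m / 2 ^ m\<close> or the summand \<open>E\<^sub>0\<close> gives the two recurrences below.
\<close>

definition coef :: "nat \<Rightarrow> nat \<Rightarrow> real" where
  "coef m r = (- 1) ^ r / (2 ^ (r choose 2) * Q r * Q (m - r))"

lemma coef_0_0 [simp]: "coef 0 0 = 1"
  by (simp add: coef_def binomial_eq_0)

lemma coef_Suc_left:
  assumes "r \<le> m"
  shows "coef (Suc m) r * (1 - 2 ^ r / 2 ^ Suc m) = coef m r"
proof -
  have "2 ^ r / 2 ^ Suc m = (1 / 2 :: real) ^ Suc (m - r)"
    using assms by (simp add: power_one_over power_diff Suc_diff_le[symmetric] flip: power_Suc)
  moreover have "1 - (1 / 2 :: real) ^ Suc (m - r) > 0"
    by (simp add: power_less_one_iff del: power_Suc)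
  ultimately show ?thesis
    using assms Q_pos[of r] Q_pos[of "m - r"]
    by (simp add: coef_def Suc_diff_le Q_Suc del: power_Suc)
qed

lemma coef_Suc_Suc:
  "coef (Suc m) (Suc r) * (1 - 2 ^ Suc r) = 2 * coef m r"
proof -
  have "(1 - 2 ^ Suc r :: real) = - (2 ^ Suc r * (1 - (1 / 2) ^ Suc r))"
    by (simp add: power_one_over field_simps)
  moreover have "1 - (1 / 2 :: real) ^ Suc r > 0"
    by (simp add: power_less_one_iff del: power_Suc)
  moreover have "(Suc r choose 2) = r + (r choose 2)"
    by (simp add: numeral_2_eq_2)
  ultimately show ?thesis
    using Q_pos[of r] Q_pos[of "m - r"]
    by (simp add: coef_def Q_Suc power_add del: power_Suc) (simp add: field_simps)
qed

text \<open>
  The density above vanishes at \<open>0\<close> as soon as there are two summands. Summing the two recurrences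
  over \<open>r\<close> and eliminating \<open>\<Sum>r. coef m r * 2 ^ r\<close> shows that the sum for \<open>Suc m\<close> is a multiple of
  the sum for \<open>m\<close>, with factor \<open>0\<close> when \<open>m = 0\<close>.
\<close>

lemma sum_coef: "(\<Sum>r\<le>Suc m. coef (Suc m) r) = 0"
proof -
  have *: "(\<Sum>r\<le>Suc m. coef (Suc m) r) * (1 - 1 / 2 ^ Suc m)
      = (\<Sum>r\<le>m. coef m r) * (1 - 1 / 2 ^ m)" for m
  proof -
    let ?X = "\<Sum>r\<le>Suc m. coef (Suc m) r" and ?Y = "\<Sum>r\<le>Suc m. coef (Suc m) r * 2 ^ r"
      and ?S = "\<Sum>r\<le>m. coef m r"
    have "(\<Sum>r\<le>Suc m. coef (Suc m) r * (1 - 2 ^ r / 2 ^ Suc m)) = ?S"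
      by (simp add: coef_Suc_left del: power_Suc)
    moreover have "(\<Sum>r\<le>Suc m. coef (Suc m) r * (1 - 2 ^ r / 2 ^ Suc m)) = ?X - ?Y / 2 ^ Suc m"
      unfolding right_diff_distrib sum_subtractf mult_1_right sum_divide_distrib times_divide_eq_right ..
    ultimately have 1: "?X - ?Y / 2 ^ Suc m = ?S" by simp
    have "(\<Sum>r\<le>Suc m. coef (Suc m) r * (1 - 2 ^ r)) = 2 * ?S"
      by (subst sum.atMost_Suc_shift) (simp add: coef_Suc_Suc sum_distrib_left del: power_Suc)
    moreover have "(\<Sum>r\<le>Suc m. coef (Suc m) r * (1 - 2 ^ r)) = ?X - ?Y"
      unfolding right_diff_distrib sum_subtractf mult_1_right ..
    ultimately have 2: "?Y = ?X - 2 * ?S" by simp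
    have 3: "1 / 2 ^ m = (2 / 2 ^ Suc m :: real)" by simp
    from 1 show ?thesis
      unfolding 2 3 by (simp add: algebra_simps diff_divide_distrib del: power_Suc sum.atMost_Suc)
  qed
  show ?thesis
  proof (induction m)
    case 0
    show ?case using *[of 0] by simp
  next
    case (Suc m)
    have "1 - 1 / 2 ^ Suc (Suc m) \<noteq> (0::real)"
      by (simp add: field_simps) (smt (verit) one_le_power)
    then show ?case using *[of "Suc m"] unfolding Suc.IH by simp
  qed
qed

text \<open>
  Binomial thinning acts on geometric sequences by halving the exponent: \<open>(1 - a) ^ i\<close> becomes
  \<open>(1 - a / 2) ^ n\<close>. Everything below is a combination of such sequences and of their derivatives
  in \<open>a\<close>.
\<close>

lemma split_avg_power: "split_avg n (\<lambda>i j. x ^ i * y ^ j) = ((x + y) / 2) ^ n"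
proof (induction n)
  case (Suc n)
  have "split_avg (Suc n) (\<lambda>i j. x ^ i * y ^ j)
      = (split_avg n (\<lambda>i j. x * (x ^ i * y ^ j)) + split_avg n (\<lambda>i j. y * (x ^ i * y ^ j))) / 2"
    by (simp add: algebra_simps)
  also have "\<dots> = ((x + y) / 2) ^ Suc n"
    unfolding split_avg_cmult Suc.IH by (simp add: algebra_simps)
  finally show ?case .
qed simp

lemma split_avg_power_left: "split_avg n (\<lambda>i j. x ^ i) = ((1 + x) / 2) ^ n"
  using split_avg_power[of n x 1] by (simp add: add.commute)

lemma split_avg_power_deriv:
  "split_avg n (\<lambda>i j. real i * x ^ (i - 1)) = real n / 2 * ((1 + x) / 2) ^ (n - 1)"
proof (induction n)
  case (Suc n)
  have "real (Suc i) * x ^ (Suc i - 1) = x * (real i * x ^ (i - 1)) + x ^ i" for i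
    by (cases i) (simp_all add: algebra_simps)
  then have "split_avg (Suc n) (\<lambda>i j. real i * x ^ (i - 1))
      = (split_avg n (\<lambda>i j. x * (real i * x ^ (i - 1)) + x ^ i)
          + split_avg n (\<lambda>i j. real i * x ^ (i - 1))) / 2"
    by (simp only: split_avg.simps)
  also have "\<dots> = ((1 + x) * (real n / 2 * ((1 + x) / 2) ^ (n - 1)) + ((1 + x) / 2) ^ n) / 2"
    unfolding split_avg_add split_avg_cmult Suc.IH split_avg_power_left
    by (simp add: algebra_simps)
  also have "\<dots> = real (Suc n) / 2 * ((1 + x) / 2) ^ (Suc n - 1)"
    by (cases n) (simp_all add: field_simps)
  finally show ?case .
qed simp

text \<open>
  Thinning replaces \<open>(1 - a) ^ i\<close> by \<open>(1 - a / 2) ^ n\<close>, while the root consumes one record; writing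
  the result with exponent \<open>n + 1\<close> divides the coefficient by \<open>1 - a / 2\<close>, which is the first
  recurrence for \<open>coef\<close>. The additional summand \<open>h = k + 1\<close> is \<open>0 ^ n\<close> and only corrects the
  value at \<open>n = 0\<close>.
\<close>

lemma mean_eq: "mean k n = 2 ^ k * (\<Sum>h\<le>k. coef k h * (1 - 2 ^ h / 2 ^ k) ^ n)"
proof (induction k arbitrary: n)
  case 0
  show ?case by (simp add: mean_0)
next
  case (Suc k)
  show ?case
  proof (cases n)
    case 0
    then show ?thesis by (simp add: mean_Suc_0 sum_coef del: sum.atMost_Suc)
  next
    case (Suc n')
    have "mean (Suc k) n = 2 * split_avg n' (\<lambda>i j. mean k i)"
      unfolding Suc mean_Suc_Suc split_avg_add using split_avg_swap[of n' "\<lambda>i j. mean k i"] by simp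
    also have "\<dots> = 2 ^ Suc k * (\<Sum>h\<le>k. coef k h * (1 - 2 ^ h / 2 ^ Suc k) ^ n')"
    proof -
      have "(1 + (1 - 2 ^ h / 2 ^ k)) / 2 = (1 - 2 ^ h / 2 ^ Suc k :: real)" for h
        by (simp add: field_simps)
      then show ?thesis
        by (simp only: Suc.IH split_avg_cmult split_avg_sum split_avg_power_left power_Suc mult.assoc)
    qed
    also have "\<dots> = 2 ^ Suc k * (\<Sum>h\<le>Suc k. coef (Suc k) h * (1 - 2 ^ h / 2 ^ Suc k) ^ n)"
    proof -
      have "coef k h * (1 - 2 ^ h / 2 ^ Suc k) ^ n' = coef (Suc k) h * (1 - 2 ^ h / 2 ^ Suc k) ^ n"
        if "h \<le> k" for h
        unfolding Suc coef_Suc_left[OF that, symmetric] power_Suc by (simp add: mult.assoc)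
      then show ?thesis using Suc by (simp del: power_Suc)
    qed
    finally show ?thesis .
  qed
qed

text \<open>
  The discrete counterpart of \<open>phi u v n\<close>: the convolution of the sequences \<open>m * (1 - v) ^ (m - 1)\<close>
  and \<open>(1 - u) ^ m\<close>, which imitate \<open>t * exp (- v * t)\<close> and \<open>exp (- u * t)\<close>.
\<close>

primrec phi_discrete :: "nat \<Rightarrow> real \<Rightarrow> real \<Rightarrow> real" where
  "phi_discrete 0 u v = 0"
| "phi_discrete (Suc n) u v = (1 - u) * phi_discrete n u v + real n * (1 - v) ^ (n - 1)"

text \<open>
  Thinning acts on \<open>phi_discrete\<close> as the dilation \<open>n \<mapsto> n / 2\<close> acts on \<open>phi\<close>; the factor \<open>1 / 4\<close> is
  that of \<open>phi_scale\<close> below.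
\<close>

lemma split_avg_phi_discrete:
  "split_avg n (\<lambda>i j. phi_discrete i u v) = phi_discrete n (u / 2) (v / 2) / 4"
proof (induction n)
  case (Suc n)
  have *: "(1 + (1 - v)) / 2 = 1 - v / 2" by (simp add: field_simps)
  show ?case
    unfolding split_avg.simps phi_discrete.simps split_avg_add split_avg_cmult Suc.IH
      split_avg_power_deriv * by (simp add: field_simps)
qed simp

text \<open>
  The factors \<open>4 ^ h\<close> and \<open>4 ^ l\<close> come from the second derivative of the exponential sum with
  coefficients \<open>coef j\<close>: a pair sum is the square of that derivative, read as a functional
  of the exponents \<open>2 ^ h + 2 ^ l\<close>.
\<close>

definition pair_sum :: "nat \<Rightarrow> (real \<Rightarrow> real) \<Rightarrow> real" where
  "pair_sum j f = (\<Sum>h\<le>j. \<Sum>l\<le>j. coef j h * coef j l * 4 ^ h * 4 ^ l * f (2 ^ h + 2 ^ l))"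

text \<open>
  With \<open>f u v = phi u v x\<close> this is the double series \<open>G x\<close>, cut off at level \<open>k\<close> and with the finite
  products \<open>Q (k - j - r)\<close> in place of \<open>Q_inf\<close>. With \<open>phi_discrete\<close> in place of \<open>phi\<close> it
  is the main part of the exact variance.
\<close>

definition kernel_sum :: "nat \<Rightarrow> (real \<Rightarrow> real \<Rightarrow> real) \<Rightarrow> real" where
  "kernel_sum k f =
     (\<Sum>j\<le>k. 1 / 2 ^ j * (\<Sum>r\<le>k - j. coef (k - j) r * pair_sum j (f (2 ^ (j + r)))))"

lemma pair_sum_add: "pair_sum j (\<lambda>v. f v + g v) = pair_sum j f + pair_sum j g"
  by (simp add: pair_sum_def algebra_simps sum.distrib)

lemma pair_sum_cmult: "pair_sum j (\<lambda>v. a * f v) = a * pair_sum j f"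
  by (simp add: pair_sum_def sum_distrib_left mult_ac)

lemma pair_sum_diff: "pair_sum j (\<lambda>v. f v - g v) = pair_sum j f - pair_sum j g"
  by (simp add: pair_sum_def algebra_simps sum_subtractf)

lemma kernel_sum_cmult: "kernel_sum k (\<lambda>u v. a * f u v) = a * kernel_sum k f"
  unfolding kernel_sum_def pair_sum_cmult sum_distrib_left by (simp add: mult_ac)

lemma split_avg_pair_sum:
  "split_avg n (\<lambda>i j. pair_sum m (f i)) = pair_sum m (\<lambda>v. split_avg n (\<lambda>i j. f i v))"
  by (simp add: pair_sum_def split_avg_sum split_avg_cmult)

lemma split_avg_kernel_sum:
  "split_avg n (\<lambda>i j. kernel_sum k (f i)) = kernel_sum k (\<lambda>u v. split_avg n (\<lambda>i j. f i u v))"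
  by (simp add: kernel_sum_def split_avg_sum split_avg_cmult split_avg_pair_sum del: times_divide_eq_left)

text \<open>
  One more record: the recursion of \<open>phi_discrete\<close> multiplies the summand \<open>r\<close> by \<open>1 - u\<close>, which
  turns \<open>coef (k + 1 - j) r\<close> into \<open>coef (k - j) r\<close>. The inhomogeneous part does not depend on \<open>r\<close>,
  so \<open>sum_coef\<close> removes it on all levels but the new one.
\<close>

lemma kernel_sum_Suc:
  "kernel_sum (Suc k) (\<lambda>u v. phi_discrete (Suc n) (u / 2 ^ Suc k) (v / 2 ^ Suc k))
   = kernel_sum k (\<lambda>u v. phi_discrete n (u / 2 ^ Suc k) (v / 2 ^ Suc k))
     + 1 / 2 ^ Suc k * pair_sum (Suc k) (\<lambda>v. real n * (1 - v / 2 ^ Suc k) ^ (n - 1))"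
proof -
  define g where "g v = real n * (1 - v / 2 ^ Suc k) ^ (n - 1)" for v
  define p where "p u v = phi_discrete n (u / 2 ^ Suc k) (v / 2 ^ Suc k)" for u v
  have step: "phi_discrete (Suc n) (u / 2 ^ Suc k) (v / 2 ^ Suc k) = (1 - u / 2 ^ Suc k) * p u v + g v" for u v
    by (simp add: p_def g_def)
  have level: "(\<Sum>r\<le>Suc k - j. coef (Suc k - j) r * pair_sum j (\<lambda>v. (1 - 2 ^ (j + r) / 2 ^ Suc k) * p (2 ^ (j + r)) v + g v))
      = (\<Sum>r\<le>k - j. coef (k - j) r * pair_sum j (p (2 ^ (j + r))))" if "j \<le> k" for j
  proof -
    have m: "Suc k - j = Suc (k - j)" using that by simp
    have quot: "2 ^ (j + r) / 2 ^ Suc k = (2 ^ r / 2 ^ Suc (k - j) :: real)" for r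
    proof -
      have "(2::real) ^ Suc k = 2 ^ j * 2 ^ Suc (k - j)"
        using that by (simp flip: power_add)
      then show ?thesis by (simp add: power_add)
    qed
    have "(\<Sum>r\<le>Suc (k - j). coef (Suc (k - j)) r * pair_sum j (\<lambda>v. (1 - 2 ^ r / 2 ^ Suc (k - j)) * p (2 ^ (j + r)) v + g v))
       = (\<Sum>r\<le>Suc (k - j). (coef (Suc (k - j)) r * (1 - 2 ^ r / 2 ^ Suc (k - j))) * pair_sum j (p (2 ^ (j + r))))
         + (\<Sum>r\<le>Suc (k - j). coef (Suc (k - j)) r) * pair_sum j g"
      unfolding pair_sum_add pair_sum_cmult distrib_left sum.distrib sum_distrib_right
      by (simp only: mult.assoc)
    also have "\<dots> = (\<Sum>r\<le>k - j. coef (k - j) r * pair_sum j (p (2 ^ (j + r))))"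
      unfolding sum_coef by (simp add: coef_Suc_left del: power_Suc)
    finally show ?thesis unfolding m quot .
  qed
  have "kernel_sum (Suc k) (\<lambda>u v. phi_discrete (Suc n) (u / 2 ^ Suc k) (v / 2 ^ Suc k))
    = (\<Sum>j\<le>k. 1 / 2 ^ j * (\<Sum>r\<le>Suc k - j. coef (Suc k - j) r *
          pair_sum j (\<lambda>v. (1 - 2 ^ (j + r) / 2 ^ Suc k) * p (2 ^ (j + r)) v + g v)))
      + 1 / 2 ^ Suc k * pair_sum (Suc k) g"
    unfolding kernel_sum_def step by simp
  also have "\<dots> = kernel_sum k p + 1 / 2 ^ Suc k * pair_sum (Suc k) g"
    unfolding kernel_sum_def using level by simp
  finally show ?thesis unfolding p_def g_def .
qed

text \<open>
  A substitute for \<open>((1 - a) * (1 - b)) ^ n = (1 - a - b + a * b) ^ n\<close>, namely its Taylor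
  polynomial of degree one in \<open>a * b\<close> for fixed \<open>1 - a - b\<close>. Unlike the power itself it satisfies the recursion
  \<open>pair_moment_Suc\<close>, in which the defect \<open>n * a\<^sup>2 * b\<^sup>2 * (1 - a - b) ^ (n - 1)\<close> is the source term of
  \<open>phi_discrete\<close>.
\<close>

definition pair_moment :: "nat \<Rightarrow> real \<Rightarrow> real \<Rightarrow> real" where
  "pair_moment n a b = (1 - a - b) ^ n + real n * a * b * (1 - a - b) ^ (n - 1)"

lemma split_avg_pair_moment:
  "split_avg n (\<lambda>i j. pair_moment i a b)
   = (1 - a / 2 - b / 2) ^ n + real n / 2 * a * b * (1 - a / 2 - b / 2) ^ (n - 1)"
proof -
  have *: "(1 + (1 - a - b)) / 2 = 1 - a / 2 - b / 2" by (simp add: field_simps)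
  have "pair_moment i a b = (1 - a - b) ^ i + (a * b) * (real i * (1 - a - b) ^ (i - 1))" for i
    by (simp add: pair_moment_def)
  then show ?thesis
    by (simp only: split_avg_add split_avg_cmult split_avg_power_left split_avg_power_deriv *) simp
qed

lemma pair_moment_Suc:
  "pair_moment (Suc n) a b + a\<^sup>2 * b\<^sup>2 * (real n * (1 - a - b) ^ (n - 1))
   = (1 - a) * (1 - b) * pair_moment n a b"
  by (cases n) (simp_all add: pair_moment_def algebra_simps power2_eq_square)

text \<open>
  Both sides satisfy the recurrence of the second moment: \<open>split_avg_pair_moment\<close> and the product of
  two means combine to \<open>4 * pair_moment n (a / 2) (b / 2)\<close>, the factors \<open>(1 - a) * (1 - b)\<close> raise the
  coefficients from \<open>k\<close> to \<open>k + 1\<close>, and the defect in \<open>pair_moment_Suc\<close> feeds the new top level of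
  \<open>kernel_sum\<close>.
\<close>

lemma second_moment_eq:
  "second_moment k n
   = 1 / 2 ^ k * kernel_sum k (\<lambda>u v. phi_discrete n (u / 2 ^ k) (v / 2 ^ k))
     + 4 ^ k * (\<Sum>h\<le>k. \<Sum>l\<le>k. coef k h * coef k l * pair_moment n (2 ^ h / 2 ^ k) (2 ^ l / 2 ^ k))"
proof (induction k arbitrary: n)
  case 0
  have "phi_discrete n 1 2 + pair_moment n 1 1 = 0 ^ n"
  proof (cases n)
    case (Suc m)
    then show ?thesis by (cases m) (simp_all add: pair_moment_def algebra_simps)
  qed (simp add: pair_moment_def)
  then show ?case by (simp add: second_moment_0 kernel_sum_def pair_sum_def)
next
  case (Suc k)
  show ?case
  proof (cases n)
    case 0
    have "(\<Sum>h\<le>Suc k. \<Sum>l\<le>Suc k. coef (Suc k) h * coef (Suc k) l) = 0"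
      by (simp only: sum_coef mult_zero_right sum.neutral_const flip: sum_distrib_left)
    then show ?thesis
      using 0 by (simp add: second_moment_Suc_0 kernel_sum_def pair_sum_def pair_moment_def
          del: sum.atMost_Suc)
  next
    case n: (Suc m)
    define a where "a h = (2 ^ h / 2 ^ Suc k :: real)" for h :: nat
    have a2: "2 ^ h / 2 ^ k = 2 * a h" for h :: nat
      by (simp add: a_def)
    define K where "K = kernel_sum k (\<lambda>u v. phi_discrete m (u / 2 ^ Suc k) (v / 2 ^ Suc k))"
    have K: "split_avg m (\<lambda>i j. kernel_sum k (\<lambda>u v. phi_discrete i (u / 2 ^ k) (v / 2 ^ k))) = K / 4"
    proof -
      have "split_avg m (\<lambda>i j. kernel_sum k (\<lambda>u v. phi_discrete i (u / 2 ^ k) (v / 2 ^ k)))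
          = kernel_sum k (\<lambda>u v. (1 / 4) * phi_discrete m (u / 2 ^ Suc k) (v / 2 ^ Suc k))"
        unfolding split_avg_kernel_sum split_avg_phi_discrete by (simp add: mult_ac)
      then show ?thesis unfolding kernel_sum_cmult K_def by simp
    qed
    have sm: "split_avg m (\<lambda>i j. second_moment k i) = 1 / 2 ^ k * (K / 4)
        + 4 ^ k * (\<Sum>h\<le>k. \<Sum>l\<le>k. coef k h * coef k l *
            ((1 - a h - a l) ^ m + 2 * (real m * a h * a l * (1 - a h - a l) ^ (m - 1))))"
      unfolding Suc.IH split_avg_add split_avg_cmult split_avg_sum K a2 split_avg_pair_moment
      by (simp add: mult_ac)
    have mm: "split_avg m (\<lambda>i j. mean k i * mean k j)
        = 4 ^ k * (\<Sum>h\<le>k. \<Sum>l\<le>k. coef k h * coef k l * (1 - a h - a l) ^ m)"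
    proof -
      have "mean k i * mean k j = 4 ^ k * (\<Sum>h\<le>k. \<Sum>l\<le>k.
          (coef k h * coef k l) * ((1 - 2 * a h) ^ i * (1 - 2 * a l) ^ j))" for i j
      proof -
        have "(2 ^ k * 2 ^ k :: real) = 4 ^ k" by (simp flip: power_mult_distrib)
        then show ?thesis
          unfolding mean_eq a2 by (simp add: sum_product mult_ac)
      qed
      moreover have "((1 - 2 * a h) + (1 - 2 * a l)) / 2 = 1 - a h - a l" for h l by simp
      ultimately show ?thesis
        by (simp only: split_avg_cmult split_avg_sum split_avg_power)
    qed
    have "second_moment (Suc k) n
        = 2 * split_avg m (\<lambda>i j. second_moment k i) + 2 * split_avg m (\<lambda>i j. mean k i * mean k j)"
      unfolding n second_moment_Suc_Suc split_avg_add split_avg_cmult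
      using split_avg_swap[of m "\<lambda>i j. second_moment k i"] by simp
    also have "\<dots> = K / 2 ^ Suc k
        + 4 ^ Suc k * (\<Sum>h\<le>k. \<Sum>l\<le>k. coef k h * coef k l * pair_moment m (a h) (a l))"
      unfolding sm mm pair_moment_def
      by (simp add: sum_distrib_left algebra_simps flip: sum.distrib)
    also have "(\<Sum>h\<le>k. \<Sum>l\<le>k. coef k h * coef k l * pair_moment m (a h) (a l))
        = (\<Sum>h\<le>Suc k. \<Sum>l\<le>Suc k. coef (Suc k) h * coef (Suc k) l *
             ((1 - a h) * (1 - a l) * pair_moment m (a h) (a l)))"
    proof -
      have top: "1 - a (Suc k) = 0" by (simp add: a_def)
      have low: "coef k h = coef (Suc k) h * (1 - a h)" if "h \<le> k" for h
        using coef_Suc_left[OF that] by (simp add: a_def)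
      have "(\<Sum>h\<le>k. \<Sum>l\<le>k. coef k h * coef k l * pair_moment m (a h) (a l))
        = (\<Sum>h\<le>k. \<Sum>l\<le>k. coef (Suc k) h * coef (Suc k) l *
             ((1 - a h) * (1 - a l) * pair_moment m (a h) (a l)))"
        by (intro sum.cong refl) (simp add: low mult_ac)
      then show ?thesis by (simp add: top)
    qed
    also have "4 ^ Suc k * (\<Sum>h\<le>Suc k. \<Sum>l\<le>Suc k. coef (Suc k) h * coef (Suc k) l *
             ((1 - a h) * (1 - a l) * pair_moment m (a h) (a l)))
        = 4 ^ Suc k * (\<Sum>h\<le>Suc k. \<Sum>l\<le>Suc k. coef (Suc k) h * coef (Suc k) l * pair_moment n (a h) (a l))
          + 1 / 4 ^ Suc k * pair_sum (Suc k) (\<lambda>v. real m * (1 - v / 2 ^ Suc k) ^ (m - 1))"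
    proof -
      have a4: "(a h)\<^sup>2 * (a l)\<^sup>2 = 4 ^ h * 4 ^ l / (4 ^ Suc k * 4 ^ Suc k)" for h l
        unfolding a_def by (simp add: power_divide power_mult[symmetric] mult.commute[of _ 2] power_mult)
      have "4 ^ Suc k * (c * ((1 - a h) * (1 - a l) * pair_moment m (a h) (a l)))
        = 4 ^ Suc k * (c * pair_moment n (a h) (a l))
          + 1 / 4 ^ Suc k * (c * 4 ^ h * 4 ^ l * (real m * (1 - (2 ^ h + 2 ^ l) / 2 ^ Suc k) ^ (m - 1)))" for c h l
      proof -
        have arg: "1 - (2 ^ h + 2 ^ l) / 2 ^ Suc k = 1 - a h - a l"
          by (simp add: a_def add_divide_distrib)
        have alg: "p * (c * (x + y * z / (p * p) * w)) = p * (c * x) + 1 / p * (c * y * z * w)"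
          if "p \<noteq> 0" for p x y z w :: real
          using that by (simp add: field_simps)
        show ?thesis
          unfolding n pair_moment_Suc[of m "a h" "a l", symmetric] a4 arg by (rule alg) simp
      qed
      then show ?thesis
        unfolding pair_sum_def sum_distrib_left sum.distrib[symmetric] by simp
    qed
    also have "K / 2 ^ Suc k + (4 ^ Suc k * (\<Sum>h\<le>Suc k. \<Sum>l\<le>Suc k. coef (Suc k) h * coef (Suc k) l * pair_moment n (a h) (a l))
          + 1 / 4 ^ Suc k * pair_sum (Suc k) (\<lambda>v. real m * (1 - v / 2 ^ Suc k) ^ (m - 1)))
        = 1 / 2 ^ Suc k * kernel_sum (Suc k) (\<lambda>u v. phi_discrete n (u / 2 ^ Suc k) (v / 2 ^ Suc k))
          + 4 ^ Suc k * (\<Sum>h\<le>Suc k. \<Sum>l\<le>Suc k. coef (Suc k) h * coef (Suc k) l * pair_moment n (a h) (a l))"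
    proof -
      have "(4::real) ^ Suc k = 2 ^ Suc k * 2 ^ Suc k" by (simp flip: power_mult_distrib)
      then show ?thesis
        unfolding n kernel_sum_Suc K_def[symmetric] by (simp add: field_simps del: power_Suc sum.atMost_Suc)
    qed
    finally show ?thesis unfolding a_def .
  qed
qed

section \<open>The discrete kernel approximates the continuous one\<close>

lemma phi_convolution:
  "phi u v x = integral {0..x} (\<lambda>t. (x - t) * exp (- (v * (x - t))) * exp (- (u * t)))"
proof -
  have "(\<lambda>t. (x - t) * exp (- (v * (x - t))) * exp (- (u * t)))
      = (\<lambda>t. exp (- (v * x)) * ((x - t) * exp (- ((u - v) * t))))"
    by (rule ext) (simp add: algebra_simps flip: exp_add)
  then show ?thesis
    by (simp add: phi_def)
qed

lemma mult_exp_neg_le_1: "y * exp (- y) \<le> (1::real)"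
proof -
  have "y \<le> exp y" using exp_ge_add_one_self[of y] by linarith
  then show ?thesis by (simp add: exp_minus field_simps)
qed

lemma mult_exp_neg_le: "0 < v \<Longrightarrow> y * exp (- (v * y)) \<le> 1 / (v::real)"
  using mult_exp_neg_le_1[of "v * y"] by (simp add: field_simps)

lemma phi_nonneg: "0 \<le> phi u v x"
  unfolding phi_convolution by (rule integral_nonneg) (auto intro!: integrable_continuous_interval continuous_intros)

lemma phi_le:
  assumes "0 < u" "0 < v" "0 \<le> x"
  shows "phi u v x \<le> 1 / (u * v)"
proof -
  have "((\<lambda>t. exp (- (u * t)) / v) has_integral (- exp (- (u * x)) / (u * v) - (- exp (- (u * 0)) / (u * v)))) {0..x}"
  proof (rule fundamental_theorem_of_calculus)
    fix t
    show "((\<lambda>t. - exp (- (u * t)) / (u * v)) has_vector_derivative exp (- (u * t)) / v) (at t within {0..x})"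
      unfolding has_real_derivative_iff_has_vector_derivative[symmetric]
      using assms by (auto intro!: derivative_eq_intros simp: field_simps)
  qed (use assms in simp)
  then have int: "integral {0..x} (\<lambda>t. exp (- (u * t)) / v) = (1 - exp (- (u * x))) / (u * v)"
    by (subst integral_unique) (auto simp: diff_divide_distrib)
  have "phi u v x \<le> integral {0..x} (\<lambda>t. exp (- (u * t)) / v)"
    unfolding phi_convolution
  proof (rule integral_le)
    fix t assume "t \<in> {0..x}"
    show "(x - t) * exp (- (v * (x - t))) * exp (- (u * t)) \<le> exp (- (u * t)) / v"
      using mult_right_mono[OF mult_exp_neg_le[OF \<open>0 < v\<close>, of "x - t"], of "exp (- (u * t))"] by simp
  qed (use assms in \<open>auto intro!: integrable_continuous_interval continuous_intros\<close>)
  also have "\<dots> \<le> 1 / (u * v)"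
    unfolding int using assms by (intro divide_right_mono) auto
  finally show ?thesis .
qed

text \<open>
  Brings the arguments \<open>2 ^ (j + r)\<close>, \<open>2 ^ h + 2 ^ l\<close> at \<open>n / 2 ^ k\<close> to the arguments of size at most
  one that occur in the exact formula at \<open>n\<close>.
\<close>

lemma phi_scale:
  assumes "0 < c" "0 \<le> x"
  shows "phi (u / c) (v / c) (c * x) = c\<^sup>2 * phi u v x"
proof (cases "u = v")
  case True
  then show ?thesis using assms by (simp add: phi_eq power_mult_distrib)
next
  case False
  then have "u / c \<noteq> v / c" using assms by simp
  then have "phi (u / c) (v / c) (c * x) = exp (- (v / c * (c * x)))
      * ((exp (- ((u / c - v / c) * (c * x))) - 1 + (u / c - v / c) * (c * x)) / (u / c - v / c)\<^sup>2)"
    using assms by (intro phi_neq) auto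
  also have "v / c * (c * x) = v * x" using assms by simp
  also have "(u / c - v / c) * (c * x) = (u - v) * x" using assms by (simp flip: diff_divide_distrib)
  also have "(u / c - v / c)\<^sup>2 = (u - v)\<^sup>2 / c\<^sup>2" by (simp flip: diff_divide_distrib add: power_divide)
  finally show ?thesis using False assms by (simp add: phi_neq)
qed

lemma phi_has_derivative:
  assumes "0 < x"
  shows "(phi u v has_real_derivative x * exp (- (v * x)) - u * phi u v x) (at x)"
proof (cases "u = v")
  case True
  have der: "((\<lambda>x. x\<^sup>2 / 2 * exp (- (u * x))) has_real_derivative x * exp (- (v * x)) - u * phi u v x) (at x)"
    using True assms by (auto intro!: derivative_eq_intros simp: phi_eq field_simps power2_eq_square)
  have ev: "eventually (\<lambda>x. phi u v x = x\<^sup>2 / 2 * exp (- (u * x))) (nhds x)"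
    using eventually_nhds_in_open[of "{0<..}" x] assms
    by (auto elim!: eventually_mono simp: True phi_eq)
  show ?thesis by (rule iffD2[OF DERIV_cong_ev[OF refl ev refl] der])
next
  case False
  define w where "w = u - v"
  have w: "w \<noteq> 0" "u = v + w" using False by (auto simp: w_def)
  have eq: "phi u v x = exp (- (v * x)) * ((exp (- (w * x)) - 1 + w * x) / w\<^sup>2)" if "0 \<le> x" for x
    using phi_neq[OF False that] by (simp add: w_def)
  have der: "((\<lambda>x. exp (- (v * x)) * ((exp (- (w * x)) - 1 + w * x) / w\<^sup>2))
      has_real_derivative x * exp (- (v * x)) - u * phi u v x) (at x)"
    unfolding eq[OF less_imp_le[OF assms]] unfolding w(2) using w(1)
    by (auto intro!: derivative_eq_intros) (simp add: field_simps power2_eq_square power4_eq_xxxx)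
  have ev: "eventually (\<lambda>x. phi u v x = exp (- (v * x)) * ((exp (- (w * x)) - 1 + w * x) / w\<^sup>2)) (nhds x)"
    using eventually_nhds_in_open[of "{0<..}" x] assms by (auto elim!: eventually_mono simp: eq)
  show ?thesis by (rule iffD2[OF DERIV_cong_ev[OF refl ev refl] der])
qed

lemma phi_continuous_on: "continuous_on {0..} (phi u v)"
proof (cases "u = v")
  case True
  have "continuous_on {0..} (\<lambda>x. x\<^sup>2 / 2 * exp (- (u * x)))" by (intro continuous_intros) auto
  then show ?thesis by (rule continuous_on_eq) (simp add: True phi_eq)
next
  case False
  have "continuous_on {0..} (\<lambda>x. exp (- (v * x)) * ((exp (- ((u - v) * x)) - 1 + (u - v) * x) / (u - v)\<^sup>2))"
    using False by (intro continuous_intros) auto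
  then show ?thesis by (rule continuous_on_eq) (simp add: False phi_neq)
qed

text \<open>
  A recursion of the same shape as that of \<open>phi_discrete\<close>. It is the mean value theorem for
  \<open>exp (u * s) * phi u v (x + s)\<close> on \<open>{0..1}\<close>, whose derivative no longer contains \<open>phi\<close>.
\<close>

lemma phi_step:
  assumes "0 \<le> x"
  obtains \<xi> where "0 < \<xi>" "\<xi> < 1"
    "phi u v (x + 1) = exp (- u) * phi u v x + exp (- (u * (1 - \<xi>))) * ((x + \<xi>) * exp (- (v * (x + \<xi>))))"
proof -
  let ?H = "\<lambda>s. exp (u * s) * phi u v (x + s)"
  have der: "(?H has_real_derivative exp (u * z) * ((x + z) * exp (- (v * (x + z))))) (at z)"
    if "0 < z" "z < 1" for z
  proof -
    have "((\<lambda>s. phi u v (x + s)) has_real_derivative (x + z) * exp (- (v * (x + z))) - u * phi u v (x + z)) (at z)"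
      using DERIV_shift[of "phi u v" _ z x] phi_has_derivative[of "x + z" u v] assms that
      by (simp add: add.commute)
    then show ?thesis by (auto intro!: derivative_eq_intros simp: algebra_simps)
  qed
  have "continuous_on {0..1} ?H"
    by (intro continuous_intros continuous_on_compose2[OF phi_continuous_on]) (use assms in auto)
  then obtain l z where "0 < z" "z < 1" "(?H has_real_derivative l) (at z)" "?H 1 - ?H 0 = (1 - 0) * l"
    using MVT[of 0 1 ?H] der real_differentiable_def by fastforce
  then obtain z where z: "0 < z" "z < 1"
    and H: "exp u * phi u v (x + 1) = phi u v x + exp (u * z) * ((x + z) * exp (- (v * (x + z))))"
    using DERIV_unique[OF _ der, of l z] by fastforce
  have "phi u v (x + 1) = exp (- u) * (exp u * phi u v (x + 1))"
    by (simp flip: mult.assoc exp_add)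
  also have "\<dots> = exp (- u) * phi u v x + exp (- (u * (1 - z))) * ((x + z) * exp (- (v * (x + z))))"
    unfolding H by (simp add: algebra_simps flip: exp_add)
  finally show ?thesis using that z by blast
qed

lemma exp_neg_quadratic:
  assumes "0 \<le> (x::real)"
  shows "1 - x \<le> exp (- x)" "exp (- x) \<le> 1 - x + x\<^sup>2"
proof -
  show "1 - x \<le> exp (- x)" using exp_ge_add_one_self[of "- x"] by simp
  have "1 \<le> (1 - x + x\<^sup>2) * (1 + x)"
    using assms by (simp add: algebra_simps power2_eq_square)
  also have "\<dots> \<le> (1 - x + x\<^sup>2) * exp x"
  proof (rule mult_left_mono)
    have "0 \<le> (1 - x)\<^sup>2 + x" using assms by simp
    also have "\<dots> = 1 - x + x\<^sup>2" by (simp add: power2_eq_square algebra_simps)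
    finally show "0 \<le> 1 - x + x\<^sup>2" .
  qed (rule exp_ge_add_one_self)
  finally show "exp (- x) \<le> 1 - x + x\<^sup>2"
    by (simp add: exp_minus field_simps)
qed

lemma power_diff_bounds:
  fixes x y :: real
  assumes "0 \<le> y" "y \<le> x"
  shows "x ^ n - y ^ n \<le> real n * x ^ (n - 1) * (x - y)"
    and "real n * y ^ (n - 1) * (x - y) \<le> x ^ n - y ^ n"
proof -
  have "x ^ n - y ^ n \<le> real n * x ^ (n - 1) * (x - y) \<and> real n * y ^ (n - 1) * (x - y) \<le> x ^ n - y ^ n"
  proof (induction n)
    case (Suc n)
    have e: "z * (real n * z ^ (n - 1) * (x - y)) = real n * z ^ n * (x - y)" for z :: real
      by (cases n) simp_all
    have "x ^ Suc n - y ^ Suc n = x * (x ^ n - y ^ n) + (x - y) * y ^ n"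
      by (simp add: algebra_simps)
    also have "\<dots> \<le> x * (real n * x ^ (n - 1) * (x - y)) + (x - y) * x ^ n"
      using Suc assms by (intro add_mono mult_left_mono power_mono) auto
    also have "\<dots> = real (Suc n) * x ^ (Suc n - 1) * (x - y)"
      unfolding e by (simp add: algebra_simps)
    finally have 1: "x ^ Suc n - y ^ Suc n \<le> real (Suc n) * x ^ (Suc n - 1) * (x - y)" .
    have "real (Suc n) * y ^ (Suc n - 1) * (x - y) = y * (real n * y ^ (n - 1) * (x - y)) + (x - y) * y ^ n"
      unfolding e by (simp add: algebra_simps)
    also have "\<dots> \<le> y * (x ^ n - y ^ n) + (x - y) * x ^ n"
      using Suc assms by (intro add_mono mult_left_mono power_mono) auto
    also have "\<dots> = x ^ Suc n - y ^ Suc n"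
      by (simp add: algebra_simps)
    finally show ?case using 1 by simp
  qed simp
  then show "x ^ n - y ^ n \<le> real n * x ^ (n - 1) * (x - y)"
    and "real n * y ^ (n - 1) * (x - y) \<le> x ^ n - y ^ n" by auto
qed

lemma mult_power_le:
  assumes "0 < v" "v \<le> 1"
  shows "real n * (1 - v) ^ (n - 1) \<le> 1 / v"
proof -
  have "real n * (1 - v) ^ (n - 1) * (1 - (1 - v)) \<le> 1 ^ n - (1 - v) ^ n"
    using assms by (intro power_diff_bounds) auto
  also have "\<dots> \<le> 1" using assms by simp
  finally show ?thesis using assms by (simp add: field_simps)
qed

text \<open>
  The bound is uniform because \<open>y * exp (- y)\<close> and \<open>y\<^sup>2 * exp (- y)\<close> are bounded for \<open>y = v * n\<close>.
\<close>

lemma mult_power_exp_error: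
  assumes "0 < v" "v \<le> 1"
  shows "\<bar>real n * (1 - v) ^ (n - 1) - real n * exp (- (v * real n))\<bar> \<le> 6"
proof (cases n)
  case (Suc m)
  have ev: "exp v \<le> 1 + 2 * v"
    using exp_bound[of v] assms by (simp add: power2_eq_square) (smt (verit) mult_left_le)
  have em: "exp (- (v * real m)) = exp (- (v * real n)) * exp v"
    by (simp add: Suc algebra_simps flip: exp_add)
  have pe: "exp (- v) ^ i = exp (- (v * real i))" for i
    by (simp add: exp_of_nat_mult[symmetric] mult.commute)
  have le: "1 - v \<le> exp (- v)" using assms by (intro exp_neg_quadratic) auto
  have y1: "(v * real n) * exp (- (v * real n)) \<le> 1" by (rule mult_exp_neg_le_1)
  have y2: "(v * real n)\<^sup>2 * exp (- (v * real n)) \<le> 2"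
  proof -
    have "1 + v * real n + (v * real n)\<^sup>2 / 2 \<le> exp (v * real n)"
      using assms by (intro exp_lower_Taylor_quadratic) auto
    moreover have "0 \<le> v * real n" using assms by simp
    ultimately have "(v * real n)\<^sup>2 \<le> 2 * exp (v * real n)" by linarith
    then show ?thesis by (simp add: exp_minus field_simps)
  qed
  have "real n * (1 - v) ^ m \<le> real n * exp (- (v * real m))"
    unfolding pe[symmetric] using le assms by (intro mult_left_mono power_mono) auto
  also have "\<dots> \<le> real n * (exp (- (v * real n)) * (1 + 2 * v))"
    unfolding em using ev by (intro mult_left_mono) auto
  also have "\<dots> = real n * exp (- (v * real n)) + 2 * ((v * real n) * exp (- (v * real n)))"
    by (simp add: algebra_simps)
  finally have 1: "real n * (1 - v) ^ m - real n * exp (- (v * real n)) \<le> 2"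
    using y1 by linarith
  have "exp (- (v * real n)) - (1 - v) ^ m \<le> exp (- v) ^ n - (1 - v) ^ n"
    unfolding pe using assms by (simp add: Suc mult_left_le_one_le)
  also have "\<dots> \<le> real n * exp (- v) ^ (n - 1) * (exp (- v) - (1 - v))"
    using le assms by (intro power_diff_bounds) auto
  also have "\<dots> \<le> real n * exp (- v) ^ (n - 1) * v\<^sup>2"
    using exp_neg_quadratic(2)[of v] assms by (intro mult_left_mono) auto
  also have "exp (- v) ^ (n - 1) = exp (- (v * real n)) * exp v"
    unfolding pe em[symmetric] by (simp add: Suc)
  finally have "real n * (exp (- (v * real n)) - (1 - v) ^ m)
      \<le> real n * (real n * (exp (- (v * real n)) * exp v) * v\<^sup>2)"
    by (intro mult_left_mono) auto
  also have "\<dots> = ((v * real n)\<^sup>2 * exp (- (v * real n))) * exp v"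
    by (simp add: power2_eq_square algebra_simps)
  also have "\<dots> \<le> 2 * 3"
    using ev assms y2 by (intro mult_mono) auto
  finally have 2: "real n * exp (- (v * real n)) - real n * (1 - v) ^ m \<le> 6"
    by (simp add: right_diff_distrib)
  show ?thesis using 1 2 unfolding abs_le_iff by (simp add: Suc)
qed simp

text \<open>
  The difference of the two recursions contracts by \<open>1 - u\<close> in each step and receives an error of
  at most \<open>7 + 2 * u / v\<close>: a bounded one from the source terms, \<open>u / v\<close> from the factor
  \<open>exp (- (u * (1 - \<xi>)))\<close>, and \<open>u / v\<close> from replacing \<open>exp (- u)\<close> by \<open>1 - u\<close>, as \<open>phi\<close> is
  at most \<open>1 / (u * v)\<close>. The stated bound is the fixed point of this contraction.
\<close>

lemma phi_discrete_error:
  assumes "0 < u" "u \<le> 1" "0 < v" "v \<le> 1"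
  shows "\<bar>phi_discrete n u v - phi u v (real n)\<bar> \<le> 7 / u + 2 / v"
proof (induction n)
  case 0
  then show ?case using assms by (simp add: phi_def)
next
  case (Suc n)
  obtain \<xi> where \<xi>: "0 < \<xi>" "\<xi> < 1"
    and step: "phi u v (real n + 1) = exp (- u) * phi u v (real n)
        + exp (- (u * (1 - \<xi>))) * ((real n + \<xi>) * exp (- (v * (real n + \<xi>))))"
    using phi_step[of "real n" u v] by auto
  define a where "a = exp (- (u * (1 - \<xi>)))"
  define \<psi> where "\<psi> t = t * exp (- (v * t))" for t :: real
  have \<psi>_shift: "\<bar>\<psi> (real n) - \<psi> (real n + \<xi>)\<bar> \<le> 1"
  proof -
    have e: "exp (- (v * (real n + \<xi>))) = exp (- (v * real n)) * exp (- (v * \<xi>))"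
      by (simp add: algebra_simps flip: exp_add)
    have "exp (- (v * (real n + \<xi>))) \<le> exp (- (v * real n))" "exp (- (v * (real n + \<xi>))) \<le> 1"
      using assms \<xi> by auto
    then have "real n * exp (- (v * (real n + \<xi>))) + \<xi> * exp (- (v * (real n + \<xi>)))
        \<le> real n * exp (- (v * real n)) + 1 * 1"
      using \<xi> by (intro add_mono mult_left_mono mult_mono) auto
    then have 1: "\<psi> (real n + \<xi>) - \<psi> (real n) \<le> 1"
      by (simp add: \<psi>_def algebra_simps)
    have "\<psi> (real n) - \<psi> (real n + \<xi>)
        \<le> real n * exp (- (v * real n)) - real n * exp (- (v * (real n + \<xi>)))"
      unfolding \<psi>_def using \<xi> by (simp add: algebra_simps)
    also have "\<dots> = real n * exp (- (v * real n)) * (1 - exp (- (v * \<xi>)))"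
      unfolding e by (simp add: algebra_simps)
    also have "\<dots> \<le> real n * exp (- (v * real n)) * (v * 1)"
    proof (rule mult_left_mono)
      have "1 - exp (- (v * \<xi>)) \<le> v * \<xi>"
        using exp_neg_quadratic(1)[of "v * \<xi>"] assms \<xi> by simp
      also have "\<dots> \<le> v * 1" using assms \<xi> by (intro mult_left_mono) auto
      finally show "1 - exp (- (v * \<xi>)) \<le> v * 1" .
    qed auto
    also have "\<dots> \<le> 1"
      using mult_exp_neg_le_1[of "v * real n"] by (simp add: mult_ac)
    finally show ?thesis using 1 by linarith
  qed
  have \<psi>_bound: "0 \<le> \<psi> (real n + \<xi>)" "\<psi> (real n + \<xi>) \<le> 1 / v"
    using \<xi> mult_exp_neg_le[OF \<open>0 < v\<close>, of "real n + \<xi>"] by (auto simp: \<psi>_def)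
  have "0 \<le> 1 - a" "1 - a \<le> u"
  proof -
    have "u * (1 - \<xi>) \<le> u * 1" using assms \<xi> by (intro mult_left_mono) auto
    moreover have "0 \<le> u * (1 - \<xi>)" using assms \<xi> by simp
    ultimately show "1 - a \<le> u"
      using exp_neg_quadratic(1)[of "u * (1 - \<xi>)"] assms \<xi> unfolding a_def mult_1_right by linarith
    show "0 \<le> 1 - a" using assms \<xi> by (simp add: a_def)
  qed
  then have "\<bar>(1 - a) * \<psi> (real n + \<xi>)\<bar> \<le> u * (1 / v)"
    unfolding abs_mult using \<psi>_bound assms by (intro mult_mono) auto
  moreover have "\<bar>real n * (1 - v) ^ (n - 1) - \<psi> (real n)\<bar> \<le> 6"
    using mult_power_exp_error assms by (simp add: \<psi>_def)
  ultimately have forcing: "\<bar>real n * (1 - v) ^ (n - 1) - a * \<psi> (real n + \<xi>)\<bar> \<le> 7 + u / v"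
    using \<psi>_shift by (simp add: algebra_simps abs_le_iff)
  have decay: "\<bar>(1 - u - exp (- u)) * phi u v (real n)\<bar> \<le> u / v"
  proof -
    have "\<bar>1 - u - exp (- u)\<bar> \<le> u\<^sup>2"
      using exp_neg_quadratic[of u] assms by (auto simp: abs_le_iff)
    then have "\<bar>(1 - u - exp (- u)) * phi u v (real n)\<bar> \<le> u\<^sup>2 * (1 / (u * v))"
      unfolding abs_mult using phi_nonneg[of u v "real n"] phi_le[of u v "real n"] assms
      by (intro mult_mono) auto
    then show ?thesis using assms by (simp add: power2_eq_square)
  qed
  have "phi_discrete (Suc n) u v - phi u v (real (Suc n))
      = (1 - u) * (phi_discrete n u v - phi u v (real n)) + (1 - u - exp (- u)) * phi u v (real n)
        + (real n * (1 - v) ^ (n - 1) - a * \<psi> (real n + \<xi>))"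
    using step by (simp add: a_def \<psi>_def algebra_simps)
  also have "\<bar>\<dots>\<bar> \<le> (1 - u) * (7 / u + 2 / v) + u / v + (7 + u / v)"
  proof -
    have "\<bar>(1 - u) * (phi_discrete n u v - phi u v (real n))\<bar> \<le> (1 - u) * (7 / u + 2 / v)"
      unfolding abs_mult using Suc.IH assms by (intro mult_mono) auto
    then show ?thesis using forcing decay by linarith
  qed
  also have "\<dots> = 7 / u + 2 / v"
    using assms by (simp add: field_simps)
  finally show ?case .
qed

text \<open>
  The Taylor remainder in \<open>a * b\<close> is at most \<open>(a * b)\<^sup>2 * n\<^sup>2 * ((1 - a) * (1 - b)) ^ (n - 2)\<close> up to a
  constant, and each factor \<open>n * (1 - a) ^ (n - 2)\<close> absorbs one factor \<open>a\<close>.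
\<close>

lemma pair_moment_error:
  assumes "0 < a" "0 < b" "a + b \<le> 1" "2 \<le> n"
  shows "\<bar>pair_moment n a b - ((1 - a) * (1 - b)) ^ n\<bar> \<le> 2 * a * b"
proof -
  define c where "c = 1 - a - b"
  define w where "w = (1 - a) * (1 - b)"
  have w: "w = c + a * b" by (simp add: c_def w_def algebra_simps)
  have c: "0 \<le> c" "c \<le> w" using assms by (auto simp: c_def w)
  obtain m where n: "n = Suc (Suc m)" using assms by (metis add_2_eq_Suc le_Suc_ex)
  have "real n * c ^ (n - 1) * (w - c) \<le> w ^ n - c ^ n"
    using c by (intro power_diff_bounds) auto
  then have lower: "pair_moment n a b \<le> w ^ n"
    by (simp add: pair_moment_def w flip: c_def) (simp add: algebra_simps)
  have "w ^ n - c ^ n - real n * a * b * c ^ (n - 1) \<le> real n * (a * b) * (w ^ (n - 1) - c ^ (n - 1))"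
    using power_diff_bounds(1)[OF c, of n] by (simp add: w algebra_simps)
  also have "\<dots> \<le> real n * (a * b) * (real (n - 1) * w ^ (n - 1 - 1) * (w - c))"
    using assms c by (intro mult_left_mono power_diff_bounds) auto
  also have "\<dots> = (a * b)\<^sup>2 * (real n * real (Suc m) * ((1 - a) ^ m * (1 - b) ^ m))"
    by (simp add: n w_def power_mult_distrib power2_eq_square) (simp add: w_def c_def algebra_simps)
  also have "\<dots> \<le> (a * b)\<^sup>2 * ((2 * real (Suc m)) * real (Suc m) * ((1 - a) ^ m * (1 - b) ^ m))"
    using assms by (intro mult_left_mono mult_right_mono) (auto simp: n)
  also have "\<dots> = (a * b)\<^sup>2 * (2 * ((real (Suc m) * (1 - a) ^ (Suc m - 1)) * (real (Suc m) * (1 - b) ^ (Suc m - 1))))"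
    by simp
  also have "\<dots> \<le> (a * b)\<^sup>2 * (2 * ((1 / a) * (1 / b)))"
    using assms by (intro mult_left_mono mult_mono mult_power_le) auto
  also have "\<dots> = 2 * a * b" using assms by (simp add: power2_eq_square)
  finally show ?thesis
    using lower unfolding pair_moment_def c_def[symmetric] w_def[symmetric] by (simp add: abs_le_iff)
qed

text \<open>
  On the top level \<open>v = a + b\<close> may exceed one, and then \<open>(1 - v) ^ n\<close> is far from \<open>exp (- v * n)\<close>; for
  \<open>a = b = 1\<close> even \<open>phi_discrete n 1 2\<close> is unbounded. But this happens only if \<open>a\<close> or \<open>b\<close> equals one,
  and then the contributions of \<open>phi_discrete\<close> and \<open>pair_moment\<close> cancel.
\<close>

lemma top_level_error:
  assumes n: "2 \<le> n"
    and a: "a = 1 \<or> 0 < a \<and> a \<le> 1 / 2" and b: "b = 1 \<or> 0 < b \<and> b \<le> 1 / 2"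
  shows "\<bar>phi_discrete n 1 (a + b) - phi 1 (a + b) (real n)
           + (pair_moment n a b - ((1 - a) * (1 - b)) ^ n) / (a\<^sup>2 * b\<^sup>2)\<bar> \<le> 4 / (a * b)"
proof -
  obtain m where m: "n = Suc (Suc m)" using n by (metis add_2_eq_Suc le_Suc_ex)
  have pos: "0 < a" "a \<le> 1" "0 < b" "b \<le> 1" using a b by auto
  have "1 * 1 \<le> (a + b) * (1 / (a * b))"
  proof -
    have "a * b \<le> a" using pos by (simp add: mult_left_le)
    then have "a * b \<le> a + b" using pos by linarith
    then show ?thesis using pos by (simp add: field_simps)
  qed
  then have ab: "1 / (a + b) \<le> 1 / (a * b)"
    using pos by (simp add: field_simps)
  have phi: "\<bar>phi 1 (a + b) (real n)\<bar> \<le> 1 / (a * b)"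
    using phi_nonneg[of 1 "a + b" "real n"] phi_le[of 1 "a + b" "real n"] ab pos by simp
  have disc: "phi_discrete n 1 (a + b) = real (Suc m) * (1 - (a + b)) ^ m"
    by (simp add: m)
  show ?thesis
  proof (cases "a = 1 \<or> b = 1")
    case True
    have cancel: "phi_discrete n 1 (1 + x) + pair_moment n 1 x / x\<^sup>2 = 0" if "0 < x" for x
      using that by (simp add: m pair_moment_def field_simps power2_eq_square)
    have sym: "pair_moment n a b = pair_moment n b a"
      by (simp add: pair_moment_def diff_diff_eq add.commute mult_ac)
    have "phi_discrete n 1 (a + b) + (pair_moment n a b - ((1 - a) * (1 - b)) ^ n) / (a\<^sup>2 * b\<^sup>2) = 0"
      using True cancel[of a] cancel[of b] pos sym m by (auto simp: add.commute)
    then have "\<bar>phi_discrete n 1 (a + b) - phi 1 (a + b) (real n)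
           + (pair_moment n a b - ((1 - a) * (1 - b)) ^ n) / (a\<^sup>2 * b\<^sup>2)\<bar> = \<bar>phi 1 (a + b) (real n)\<bar>"
      by linarith
    also have "\<dots> \<le> 4 / (a * b)" using phi pos by (simp add: field_simps)
    finally show ?thesis .
  next
    case False
    then have le: "a + b \<le> 1" using a b by auto
    have "\<bar>phi_discrete n 1 (a + b)\<bar> \<le> 1 / (a * b)"
      using mult_power_le[of "a + b" "Suc m"] le pos ab unfolding disc by (simp add: abs_mult)
    moreover have "\<bar>(pair_moment n a b - ((1 - a) * (1 - b)) ^ n) / (a\<^sup>2 * b\<^sup>2)\<bar> \<le> 2 * a * b / (a\<^sup>2 * b\<^sup>2)"
      unfolding abs_divide using pair_moment_error[OF pos(1,3) le n] pos
      by (simp add: divide_right_mono)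
    moreover have "2 * a * b / (a\<^sup>2 * b\<^sup>2) = 2 * (1 / (a * b))" "4 / (a * b) = 4 * (1 / (a * b))"
      using pos by (simp_all add: power2_eq_square)
    ultimately show ?thesis using phi by linarith
  qed
qed

section \<open>Bounds for the coefficients\<close>

lemma Q_le_1: "Q n \<le> 1"
  unfolding Q_def by (rule prod_le_1) (auto simp: power_le_one)

text \<open>
  The Weierstrass product inequality \<open>\<Prod>(1 - x\<^sub>i) \<ge> 1 - \<Sum>x\<^sub>i\<close> with the geometric sum from \<open>m + 1\<close> to
  \<open>n\<close> evaluated.
\<close>

lemma Q_lower:
  assumes "m \<le> n"
  shows "Q m * (1 - 1 / 2 ^ m + 1 / 2 ^ n) \<le> Q n"
  using assms
proof (induction n rule: dec_induct)
  case (step n)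
  have a: "1 / 2 ^ n \<le> (1 / 2 ^ m :: real)"
    using step by (simp add: frac_le)
  have "1 - 1 / 2 ^ m + 1 / 2 ^ Suc n \<le> (1 - 1 / 2 ^ m + 1 / 2 ^ n) * (1 - 1 / 2 ^ Suc n :: real)"
  proof -
    have "(1 - 1 / 2 ^ m + 1 / 2 ^ n) * (1 / 2 ^ Suc n) \<le> 1 * (1 / 2 ^ Suc n :: real)"
      using a by (intro mult_right_mono) auto
    then show ?thesis by (simp add: algebra_simps)
  qed
  then have "Q m * (1 - 1 / 2 ^ m + 1 / 2 ^ Suc n)
      \<le> Q m * ((1 - 1 / 2 ^ m + 1 / 2 ^ n) * (1 - 1 / 2 ^ Suc n))"
    using Q_pos[of m] by (intro mult_left_mono) auto
  also have "\<dots> = (Q m * (1 - 1 / 2 ^ m + 1 / 2 ^ n)) * (1 - (1 / 2) ^ Suc n)"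
    by (simp add: power_one_over)
  also have "\<dots> \<le> Q n * (1 - (1 / 2) ^ Suc n)"
    using step.IH by (intro mult_right_mono) (auto simp: power_le_one simp del: power_Suc)
  finally show ?case by (simp add: Q_Suc)
qed simp

lemma Q_tendsto: "Q \<longlonglongrightarrow> Q_inf"
proof -
  have "summable (\<lambda>l. (1 / 2 :: real) ^ Suc l)"
    by (subst summable_Suc_iff) (rule summable_geometric, simp)
  then have "convergent_prod (\<lambda>l. 1 - (1 / 2 :: real) ^ Suc l)"
    by (intro abs_convergent_prod_imp_convergent_prod)
      (simp add: abs_convergent_prod_conv_summable norm_power del: power_Suc)
  then have "(\<lambda>n. \<Prod>l\<le>n. 1 - (1 / 2 :: real) ^ Suc l) \<longlonglongrightarrow> Q_inf"
    unfolding Q_inf_def by (rule convergent_prod_LIMSEQ)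
  moreover have "(\<Prod>l\<le>n. 1 - (1 / 2 :: real) ^ Suc l) = Q (Suc n)" for n
    unfolding Q_def by (rule prod.reindex_bij_witness[of _ "\<lambda>l. l - 1" Suc]) auto
  ultimately show ?thesis by (simp add: filterlim_sequentially_Suc)
qed

lemma Q_inf_lower: "Q m * (1 - 1 / 2 ^ m) \<le> Q_inf"
proof (rule LIMSEQ_le_const[OF Q_tendsto], intro exI allI impI)
  fix n assume "m \<le> n"
  have "Q m * (1 - 1 / 2 ^ m) \<le> Q m * (1 - 1 / 2 ^ m + 1 / 2 ^ n)"
    using Q_pos[of m] by (intro mult_left_mono) auto
  also have "\<dots> \<le> Q n" using \<open>m \<le> n\<close> by (rule Q_lower)
  finally show "Q m * (1 - 1 / 2 ^ m) \<le> Q n" .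
qed

lemma Q_inf_le: "Q_inf \<le> Q m"
proof -
  have "decseq Q"
  proof (rule decseq_SucI)
    show "Q (Suc n) \<le> Q n" for n
      unfolding Q_Suc using Q_pos[of n] by (simp add: mult_left_le)
  qed
  then show ?thesis using Q_tendsto by (rule decseq_ge)
qed

lemma Q_inf_ge_quarter: "1 / 4 \<le> Q_inf"
  using Q_inf_lower[of 1] Q_Suc[of 0] by simp

lemma Q_ge_quarter: "1 / 4 \<le> Q m"
  using Q_inf_ge_quarter Q_inf_le[of m] by linarith

lemma inverse_Q_le: "1 / Q m \<le> 4" "1 / Q_inf \<le> 4"
  using Q_ge_quarter[of m] Q_inf_ge_quarter by (simp_all add: field_simps)

lemma inverse_Q_error: "\<bar>1 / Q m - 1 / Q_inf\<bar> \<le> 4 / 2 ^ m"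
proof -
  have pos: "0 < Q m" "0 < Q_inf" using Q_pos Q_inf_ge_quarter by auto
  have "\<bar>1 / Q m - 1 / Q_inf\<bar> = (Q m - Q_inf) / (Q m * Q_inf)"
    using pos Q_inf_le[of m] by (simp add: field_simps abs_if)
  also have "\<dots> \<le> (Q m / 2 ^ m) / (Q m * Q_inf)"
    using Q_inf_lower[of m] pos by (intro divide_right_mono) (auto simp: algebra_simps)
  also have "\<dots> = (1 / Q_inf) / 2 ^ m" using pos by simp
  also have "\<dots> \<le> 4 / 2 ^ m" using inverse_Q_le by (intro divide_right_mono) auto
  finally show ?thesis .
qed

text \<open>
  The limit of \<open>coef m r\<close> as \<open>m\<close> tends to infinity.
\<close>

definition coef_inf :: "nat \<Rightarrow> real" where
  "coef_inf r = (- 1) ^ r / (2 ^ (r choose 2) * Q r * Q_inf)"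

text \<open>
  At the integers the parabola \<open>r choose 2\<close> lies above the line \<open>3 * r - 6\<close> through its points at \<open>3\<close>
  and \<open>4\<close>, so the coefficients decay at least like \<open>8 ^ - r\<close>. This leaves room for the factors \<open>4 ^ h\<close> and a geometric series.
\<close>

lemma power_8_le: "8 ^ r \<le> (64 * 2 ^ (r choose 2) :: real)"
proof -
  have "3 * r \<le> 6 + (r choose 2)"
  proof (induction r)
    case (Suc r)
    have "(Suc r choose 2) = r + (r choose 2)" by (simp add: numeral_2_eq_2)
    moreover have "r < 3 \<or> 3 \<le> r" by linarith
    moreover have "r = 2 \<Longrightarrow> (r choose 2) = 1" by simp
    ultimately show ?case using Suc by (cases "r = 2") auto
  qed simp
  then have "(2::real) ^ (3 * r) \<le> 2 ^ (6 + (r choose 2))"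
    by (intro power_increasing) auto
  then show ?thesis by (simp add: power_add power_mult)
qed

lemma inverse_binomial_power_le: "1 / 2 ^ (r choose 2) \<le> (64 / 8 ^ r :: real)"
  using power_8_le[of r] by (simp add: field_simps)

lemma abs_coef_le: "\<bar>coef m r\<bar> \<le> 1024 / 8 ^ r"
proof -
  have "\<bar>coef m r\<bar> = 1 / 2 ^ (r choose 2) * (1 / Q r) * (1 / Q (m - r))"
    using Q_pos by (simp add: coef_def abs_mult power_abs less_imp_le)
  also have "\<dots> \<le> 64 / 8 ^ r * 4 * 4"
    using Q_pos[of r] Q_pos[of "m - r"]
    by (intro mult_mono inverse_binomial_power_le inverse_Q_le) auto
  finally show ?thesis by simp
qed

lemma abs_coef_inf_le: "\<bar>coef_inf r\<bar> \<le> 1024 / 8 ^ r"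
proof -
  have "\<bar>coef_inf r\<bar> = 1 / 2 ^ (r choose 2) * (1 / Q r) * (1 / Q_inf)"
    using Q_pos Q_inf_ge_quarter by (simp add: coef_inf_def abs_mult power_abs less_imp_le)
  also have "\<dots> \<le> 64 / 8 ^ r * 4 * 4"
    using Q_pos[of r] Q_inf_ge_quarter
    by (intro mult_mono inverse_binomial_power_le inverse_Q_le) auto
  finally show ?thesis by simp
qed

lemma coef_error:
  assumes "r \<le> m"
  shows "\<bar>coef m r - coef_inf r\<bar> \<le> 1024 / (4 ^ r * 2 ^ m)"
proof -
  have "\<bar>coef m r - coef_inf r\<bar> = \<bar>(- 1) ^ r * (1 / 2 ^ (r choose 2) * (1 / Q r) * (1 / Q (m - r) - 1 / Q_inf))\<bar>"
  proof -
    have "coef m r = (- 1) ^ r * (1 / 2 ^ (r choose 2) * (1 / Q r) * (1 / Q (m - r)))"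
      "coef_inf r = (- 1) ^ r * (1 / 2 ^ (r choose 2) * (1 / Q r) * (1 / Q_inf))"
      by (simp_all add: coef_def coef_inf_def)
    then show ?thesis by (simp only: right_diff_distrib)
  qed
  also have "\<dots> = 1 / 2 ^ (r choose 2) * (1 / Q r) * \<bar>1 / Q (m - r) - 1 / Q_inf\<bar>"
    using Q_pos[of r] by (simp add: abs_mult power_abs)
  also have "\<dots> \<le> 64 / 8 ^ r * 4 * (4 / 2 ^ (m - r))"
    using Q_pos[of r]
    by (intro mult_mono inverse_binomial_power_le inverse_Q_le inverse_Q_error) auto
  also have "\<dots> = 1024 / (4 ^ r * 2 ^ m)"
  proof -
    have "(8::real) ^ r = 4 ^ r * 2 ^ r" by (simp flip: power_mult_distrib)
    then show ?thesis using assms by (simp add: power_diff)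
  qed
  finally show ?thesis .
qed

lemma sum_inverse_power_2_le: "(\<Sum>i\<le>m. 1 / 2 ^ i) \<le> (2::real)"
proof -
  have "(\<Sum>i\<le>m. 1 / 2 ^ i) = 2 - (1 / 2 ^ m :: real)"
    by (induction m) auto
  then show ?thesis by simp
qed

lemma abs_coef_mult_power_le: "\<bar>coef m r\<bar> * 4 ^ r \<le> 1024 / 2 ^ r"
proof -
  have "(8::real) ^ r = 4 ^ r * 2 ^ r" by (simp flip: power_mult_distrib)
  then show ?thesis using mult_right_mono[OF abs_coef_le[of m r], of "4 ^ r"] by simp
qed

lemma sum_abs_coef_le: "(\<Sum>r\<le>m. \<bar>coef m r\<bar>) \<le> 2048"
proof -
  have "(\<Sum>r\<le>m. \<bar>coef m r\<bar>) \<le> (\<Sum>r\<le>m. 1024 * (1 / 2 ^ r))"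
  proof (rule sum_mono)
    fix r
    have "\<bar>coef m r\<bar> * 1 \<le> \<bar>coef m r\<bar> * 4 ^ r" by (intro mult_left_mono) auto
    then show "\<bar>coef m r\<bar> \<le> 1024 * (1 / 2 ^ r)" using abs_coef_mult_power_le[of m r] by simp
  qed
  also have "\<dots> \<le> 1024 * 2"
    unfolding sum_distrib_left[symmetric] by (intro mult_left_mono sum_inverse_power_2_le) auto
  finally show ?thesis by simp
qed

lemma double_sum_coef_le:
  assumes "\<And>h l. h \<le> j \<Longrightarrow> l \<le> j \<Longrightarrow> \<bar>f h l\<bar> \<le> M"
  shows "\<bar>\<Sum>h\<le>j. \<Sum>l\<le>j. coef j h * coef j l * 4 ^ h * 4 ^ l * f h l\<bar> \<le> 2 ^ 22 * M"
proof -
  have M: "0 \<le> M" using assms[of 0 0] by auto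
  have "\<bar>\<Sum>h\<le>j. \<Sum>l\<le>j. coef j h * coef j l * 4 ^ h * 4 ^ l * f h l\<bar>
      \<le> (\<Sum>h\<le>j. \<Sum>l\<le>j. (1024 / 2 ^ h) * (1024 / 2 ^ l) * M)"
  proof (intro order_trans[OF sum_abs] sum_mono)
    fix h l assume "h \<in> {..j}" "l \<in> {..j}"
    have "\<bar>coef j h * coef j l * 4 ^ h * 4 ^ l * f h l\<bar>
        = (\<bar>coef j h\<bar> * 4 ^ h) * (\<bar>coef j l\<bar> * 4 ^ l) * \<bar>f h l\<bar>"
      by (simp add: abs_mult)
    also have "\<dots> \<le> (1024 / 2 ^ h) * (1024 / 2 ^ l) * M"
      using assms \<open>h \<in> _\<close> \<open>l \<in> _\<close> by (intro mult_mono abs_coef_mult_power_le) auto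
    finally show "\<bar>coef j h * coef j l * 4 ^ h * 4 ^ l * f h l\<bar> \<le> (1024 / 2 ^ h) * (1024 / 2 ^ l) * M" .
  qed
  also have "\<dots> = 1024\<^sup>2 * M * ((\<Sum>h\<le>j. 1 / 2 ^ h) * (\<Sum>l\<le>j. 1 / 2 ^ l))"
    unfolding sum_product unfolding sum_distrib_left by (intro sum.cong refl) (simp add: power2_eq_square)
  also have "\<dots> \<le> 1024\<^sup>2 * M * (2 * 2)"
    using M by (intro mult_left_mono mult_mono sum_inverse_power_2_le) (auto intro: sum_nonneg)
  finally show ?thesis by simp
qed

lemma pair_sum_le:
  assumes "\<And>h l. h \<le> j \<Longrightarrow> l \<le> j \<Longrightarrow> \<bar>f (2 ^ h + 2 ^ l)\<bar> \<le> M"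
  shows "\<bar>pair_sum j f\<bar> \<le> 2 ^ 22 * M"
  unfolding pair_sum_def using assms by (rule double_sum_coef_le)

lemma pair_sum_phi_le:
  assumes "0 \<le> x"
  shows "\<bar>pair_sum j (\<lambda>v. phi (2 ^ i) v x)\<bar> \<le> 2 ^ 22 * (1 / 2 ^ i)"
proof (rule pair_sum_le)
  fix h l :: nat
  have "(1::real) \<le> 2 ^ h" "(1::real) \<le> 2 ^ l" by simp_all
  then have v: "(1::real) \<le> 2 ^ h + 2 ^ l" by linarith
  have "phi (2 ^ i) (2 ^ h + 2 ^ l) x \<le> 1 / (2 ^ i * (2 ^ h + 2 ^ l))"
    using assms v by (intro phi_le) auto
  also have "\<dots> \<le> 1 / 2 ^ i" using v by (intro divide_left_mono) auto
  finally show "\<bar>phi (2 ^ i) (2 ^ h + 2 ^ l) x\<bar> \<le> 1 / 2 ^ i" using phi_nonneg by simp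
qed

section \<open>Convergence of the truncated sums to G\<close>

lemma infsum_geometric:
  fixes f :: "nat \<times> nat \<Rightarrow> real"
  assumes "\<And>j r. \<bar>f (j, r)\<bar> \<le> B * (1 / 2 ^ j * (1 / 2 ^ r))"
  shows "f summable_on UNIV" and "\<bar>infsum f UNIV\<bar> \<le> 4 * B"
proof -
  have B: "0 \<le> B" using assms[of 0 0] by simp
  have fin: "(\<Sum>p\<in>F. \<bar>f p\<bar>) \<le> 4 * B" if F: "finite F" for F
  proof -
    obtain m where m: "fst ` F \<union> snd ` F \<subseteq> {..m}"
      using F finite_nat_iff_bounded_le[of "fst ` F \<union> snd ` F"] by auto
    have "(\<Sum>p\<in>F. \<bar>f p\<bar>) \<le> (\<Sum>p\<in>{..m} \<times> {..m}. \<bar>f p\<bar>)"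
      using m by (intro sum_mono2) force+
    also have "\<dots> \<le> (\<Sum>(j, r)\<in>{..m} \<times> {..m}. B * (1 / 2 ^ j * (1 / 2 ^ r)))"
      using assms by (intro sum_mono) auto
    also have "\<dots> = B * ((\<Sum>j\<le>m. 1 / 2 ^ j) * (\<Sum>r\<le>m. 1 / 2 ^ r))"
      unfolding sum_product unfolding sum_distrib_left by (simp add: sum.cartesian_product)
    also have "\<dots> \<le> B * (2 * 2)"
      using B by (intro mult_left_mono mult_mono sum_inverse_power_2_le) (auto intro: sum_nonneg)
    finally show ?thesis by simp
  qed
  have abs: "(\<lambda>p. norm (f p)) summable_on UNIV"
    by (rule nonneg_bdd_above_summable_on) (use fin in \<open>auto intro!: bdd_aboveI2[of _ _ "4 * B"]\<close>)
  then show "f summable_on UNIV" by (rule abs_summable_summable)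
  have "\<bar>infsum f UNIV\<bar> \<le> infsum (\<lambda>p. norm (f p)) UNIV"
    using norm_infsum_bound[OF abs] by simp
  also have "\<dots> \<le> 4 * B"
    using fin by (intro infsum_le_finite_sums abs) auto
  finally show "\<bar>infsum f UNIV\<bar> \<le> 4 * B" .
qed

lemma G_eq:
  "G x = (\<Sum>\<^sub>\<infinity>(j, r)\<in>UNIV. 1 / 2 ^ j * (coef_inf r * pair_sum j (\<lambda>v. phi (2 ^ (j + r)) v x)))"
proof -
  have "G_term j r h l x = 1 / 2 ^ j * (coef_inf r *
      (coef j h * coef j l * 4 ^ h * 4 ^ l * phi (2 ^ (j + r)) (2 ^ h + 2 ^ l) x))" for j r h l
  proof -
    have "(2::real) powi (2 * int i) = 4 ^ i" for i by (simp add: power_int_mult)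
    then have "(2::real) powi (- int j - int (r choose 2) - int (h choose 2) - int (l choose 2) + 2 * int h + 2 * int l)
        = 4 ^ h * 4 ^ l / (2 ^ j * 2 ^ (r choose 2) * 2 ^ (h choose 2) * 2 ^ (l choose 2))"
      by (simp add: power_int_add power_int_diff power_int_minus field_simps)
    then show ?thesis
      unfolding G_term_def coef_def coef_inf_def by (simp add: power_add mult_ac)
  qed
  then show ?thesis
    unfolding G_def pair_sum_def by (simp add: sum_distrib_left atLeast0AtMost)
qed

text \<open>
  Compare summand by summand. Where \<open>j + r \<le> k\<close>, the coefficients differ by \<open>O(2 ^ (j - k))\<close> and \<open>phi\<close> has size
  \<open>2 ^ - (j + r)\<close>, which together with the weight \<open>2 ^ - j\<close> leaves \<open>2 ^ - k\<close> times a geometric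
  term. The missing summands \<open>j + r > k\<close> are smaller than \<open>2 ^ - k\<close> by their own decay.
\<close>

lemma kernel_sum_phi_error:
  assumes "0 \<le> x"
  shows "\<bar>kernel_sum k (\<lambda>u v. phi u v x) - G x\<bar> \<le> 2 ^ 34 / 2 ^ k"
proof -
  define p where "p j r = pair_sum j (\<lambda>v. phi (2 ^ (j + r)) v x)" for j r
  define g where "g = (\<lambda>(j, r). 1 / 2 ^ j * (coef_inf r * p j r))"
  define gk where "gk = (\<lambda>(j, r). if j + r \<le> k then 1 / 2 ^ j * (coef (k - j) r * p j r) else 0)"
  have p: "\<bar>p j r\<bar> \<le> 2 ^ 22 * (1 / 2 ^ j * (1 / 2 ^ r))" for j r
    using pair_sum_phi_le[OF assms, of j "j + r"] by (simp add: p_def power_add)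
  have g_le: "\<bar>g (j, r)\<bar> \<le> 2 ^ 32 * (1 / 2 ^ j * (1 / 2 ^ r)) * (1 / 2 ^ j * (1 / 8 ^ r))" for j r
  proof -
    have "\<bar>g (j, r)\<bar> = 1 / 2 ^ j * (\<bar>coef_inf r\<bar> * \<bar>p j r\<bar>)" by (simp add: g_def abs_mult)
    also have "\<dots> \<le> 1 / 2 ^ j * (1024 / 8 ^ r * (2 ^ 22 * (1 / 2 ^ j * (1 / 2 ^ r))))"
      by (intro mult_left_mono mult_mono abs_coef_inf_le p) auto
    finally show ?thesis by (simp add: mult_ac)
  qed
  have g_sum: "g summable_on UNIV"
  proof (rule infsum_geometric)
    fix j r
    have "1 / 2 ^ j * (1 / 8 ^ r) \<le> 1 * (1::real)" by (intro mult_mono) auto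
    then have "2 ^ 32 * (1 / 2 ^ j * (1 / 2 ^ r)) * (1 / 2 ^ j * (1 / 8 ^ r))
        \<le> 2 ^ 32 * (1 / 2 ^ j * (1 / 2 ^ r)) * (1::real)" by (intro mult_left_mono) auto
    then show "\<bar>g (j, r)\<bar> \<le> 2 ^ 32 * (1 / 2 ^ j * (1 / 2 ^ r))"
      using g_le[of j r] by simp
  qed
  have diff: "\<bar>(\<lambda>p. gk p - g p) (j, r)\<bar> \<le> 2 ^ 32 / 2 ^ k * (1 / 2 ^ j * (1 / 2 ^ r))" for j r
  proof (cases "j + r \<le> k")
    case True
    have "\<bar>gk (j, r) - g (j, r)\<bar> = 1 / 2 ^ j * (\<bar>coef (k - j) r - coef_inf r\<bar> * \<bar>p j r\<bar>)"
      using True by (simp add: gk_def g_def abs_mult flip: right_diff_distrib left_diff_distrib diff_divide_distrib)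
    also have "\<dots> \<le> 1 / 2 ^ j * (1024 / (4 ^ r * 2 ^ (k - j)) * (2 ^ 22 * (1 / 2 ^ j * (1 / 2 ^ r))))"
      using True by (intro mult_left_mono mult_mono coef_error p) auto
    also have "\<dots> = 2 ^ 32 / 2 ^ k * (1 / 2 ^ j * (1 / 2 ^ r)) * (1 / 4 ^ r)"
      using True by (simp add: power_diff)
    also have "\<dots> \<le> 2 ^ 32 / 2 ^ k * (1 / 2 ^ j * (1 / 2 ^ r)) * 1"
      by (intro mult_left_mono) auto
    finally show ?thesis by simp
  next
    case False
    have "(2::real) ^ k \<le> 2 ^ (j + r)" using False by (intro power_increasing) auto
    also have "\<dots> \<le> 2 ^ j * 8 ^ r" unfolding power_add by (intro mult_left_mono power_mono) auto
    finally have "1 / 2 ^ j * (1 / 8 ^ r) \<le> (1 / 2 ^ k :: real)"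
      by (simp add: frac_le)
    then have "2 ^ 32 * (1 / 2 ^ j * (1 / 2 ^ r)) * (1 / 2 ^ j * (1 / 8 ^ r))
        \<le> 2 ^ 32 * (1 / 2 ^ j * (1 / 2 ^ r)) * (1 / 2 ^ k :: real)"
      by (intro mult_left_mono) auto
    then show ?thesis using g_le[of j r] False by (simp add: gk_def mult_ac)
  qed
  have "kernel_sum k (\<lambda>u v. phi u v x) = (\<Sum>j\<le>k. \<Sum>r\<le>k - j. gk (j, r))"
    unfolding kernel_sum_def gk_def p_def by (simp add: sum_distrib_left le_diff_conv2 add.commute)
  also have "\<dots> = sum gk (SIGMA j:{..k}. {..k - j})"
    by (simp add: sum.Sigma)
  also have "\<dots> = infsum gk (SIGMA j:{..k}. {..k - j})" by simp
  also have "\<dots> = infsum gk UNIV"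
    by (rule infsum_cong_neutral) (auto simp: gk_def split: if_splits)
  finally have 1: "kernel_sum k (\<lambda>u v. phi u v x) = infsum gk UNIV" .
  have "infsum (\<lambda>p. (gk p - g p) + g p) UNIV = infsum (\<lambda>p. gk p - g p) UNIV + infsum g UNIV"
    by (rule infsum_add) (use infsum_geometric(1)[OF diff] g_sum in auto)
  then have "kernel_sum k (\<lambda>u v. phi u v x) - G x = infsum (\<lambda>p. gk p - g p) UNIV"
    using 1 unfolding G_eq g_def p_def by simp
  then show ?thesis using infsum_geometric(2)[OF diff] by simp
qed

text \<open>
  Levels \<open>j < k\<close>: each kernel error is \<open>O(2 ^ k)\<close> by \<open>phi_discrete_error\<close>, since the arguments are at
  least \<open>2 ^ - k\<close>, and the weights \<open>2 ^ - j\<close> and the prefactor \<open>2 ^ - k\<close> make the total bounded.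
  Level \<open>j = k\<close>: the kernel error is combined with the difference between \<open>pair_moment\<close> and its
  counterpart in the squared mean, and \<open>top_level_error\<close> bounds both by \<open>O(4 ^ k)\<close>, which the prefactor \<open>4 ^ - k\<close>
  compensates.
\<close>

lemma second_moment_minus_kernel_sum:
  assumes n: "2 \<le> n"
  shows "\<bar>second_moment k n - (mean k n)\<^sup>2 - 2 ^ k * kernel_sum k (\<lambda>u v. phi u v (real n / 2 ^ k))\<bar> \<le> 2 ^ 38"
proof -
  define a where "a h = (2 ^ h / 2 ^ k :: real)" for h :: nat
  define D where "D u v = phi_discrete n (u / 2 ^ k) (v / 2 ^ k) - phi (u / 2 ^ k) (v / 2 ^ k) (real n)" for u v
  define E where "E h l = pair_moment n (a h) (a l) - ((1 - a h) * (1 - a l)) ^ n" for h l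
  define T where "T j = 1 / 2 ^ j * (\<Sum>r\<le>k - j. coef (k - j) r * pair_sum j (D (2 ^ (j + r))))" for j
  \<comment> \<open>\<open>D\<close> is the kernel error, collected in \<open>T j\<close> for level \<open>j\<close>, and \<open>E\<close> the error of \<open>pair_moment\<close>\<close>
  have four: "(4::real) ^ k = 2 ^ k * 2 ^ k" by (simp flip: power_mult_distrib)
  have scale: "2 ^ k * kernel_sum k (\<lambda>u v. phi u v (real n / 2 ^ k))
      = 1 / 2 ^ k * kernel_sum k (\<lambda>u v. phi (u / 2 ^ k) (v / 2 ^ k) (real n))"
  proof -
    have "phi (u / 2 ^ k) (v / 2 ^ k) (real n) = 4 ^ k * phi u v (real n / 2 ^ k)" for u v
      using phi_scale[of "2 ^ k" "real n / 2 ^ k" u v] by (simp add: four power2_eq_square)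
    then show ?thesis by (simp add: kernel_sum_cmult four)
  qed
  have kd: "kernel_sum k (\<lambda>u v. phi_discrete n (u / 2 ^ k) (v / 2 ^ k))
      - kernel_sum k (\<lambda>u v. phi (u / 2 ^ k) (v / 2 ^ k) (real n)) = sum T {..k}"
    unfolding kernel_sum_def T_def D_def pair_sum_diff
    by (simp add: sum_subtractf right_diff_distrib diff_divide_distrib)
  have sq: "(mean k n)\<^sup>2 = 4 ^ k * (\<Sum>h\<le>k. \<Sum>l\<le>k. coef k h * coef k l * ((1 - a h) * (1 - a l)) ^ n)"
    unfolding mean_eq power2_eq_square a_def
    by (simp add: four sum_product power_mult_distrib mult_ac)
  have "second_moment k n - (mean k n)\<^sup>2 - 2 ^ k * kernel_sum k (\<lambda>u v. phi u v (real n / 2 ^ k))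
      = 1 / 2 ^ k * sum T {..k} + 4 ^ k * (\<Sum>h\<le>k. \<Sum>l\<le>k. coef k h * coef k l * E h l)"
    unfolding second_moment_eq scale sq kd[symmetric] E_def
    by (simp add: a_def right_diff_distrib sum_subtractf)
  also have "sum T {..k} = sum T {..<k} + T k"
    by (simp add: lessThan_Suc_atMost[symmetric])
  also have "1 / 2 ^ k * (sum T {..<k} + T k) + 4 ^ k * (\<Sum>h\<le>k. \<Sum>l\<le>k. coef k h * coef k l * E h l)
      = 1 / 2 ^ k * sum T {..<k} + 1 / 4 ^ k * (\<Sum>h\<le>k. \<Sum>l\<le>k. coef k h * coef k l * 4 ^ h * 4 ^ l *
          (D (2 ^ k) (2 ^ h + 2 ^ l) + E h l / ((a h)\<^sup>2 * (a l)\<^sup>2)))"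
  proof -
    \<comment> \<open>both errors of level \<open>k\<close> get the same coefficients, because
      \<open>(a h)\<^sup>2 * (a l)\<^sup>2 = 4 ^ h * 4 ^ l / 16 ^ k\<close>\<close>
    have "4 ^ k * (c * E h l) = 1 / 4 ^ k * (c * 4 ^ h * 4 ^ l * (E h l / ((a h)\<^sup>2 * (a l)\<^sup>2)))" for c h l
    proof -
      have "(a i)\<^sup>2 = 4 ^ i / 4 ^ k" for i
        unfolding a_def by (simp add: power_divide power_mult[symmetric] mult.commute[of _ 2] power_mult)
      then show ?thesis by simp
    qed
    then have "4 ^ k * (\<Sum>h\<le>k. \<Sum>l\<le>k. coef k h * coef k l * E h l)
        = 1 / 4 ^ k * (\<Sum>h\<le>k. \<Sum>l\<le>k. coef k h * coef k l * 4 ^ h * 4 ^ l * (E h l / ((a h)\<^sup>2 * (a l)\<^sup>2)))"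
      unfolding sum_distrib_left by simp
    moreover have "T k = 1 / 2 ^ k * pair_sum k (D (2 ^ k))"
      by (simp add: T_def)
    ultimately show ?thesis
      unfolding pair_sum_def by (simp add: distrib_left sum.distrib four)
  qed
  also have "\<bar>\<dots>\<bar> \<le> 9 * 2 ^ 34 + 2 ^ 24"
  proof -
    have "\<bar>D (2 ^ k) (2 ^ h + 2 ^ l) + E h l / ((a h)\<^sup>2 * (a l)\<^sup>2)\<bar> \<le> 4 * 4 ^ k" if "h \<le> k" "l \<le> k" for h l
    proof -
      have dyadic: "a i = 1 \<or> 0 < a i \<and> a i \<le> 1 / 2" if "i \<le> k" for i
      proof (cases "i = k")
        case False
        then have "(2::real) ^ Suc i \<le> 2 ^ k" using that by (intro power_increasing) auto
        then show ?thesis by (simp add: a_def field_simps)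
      qed (simp add: a_def)
      have "\<bar>D (2 ^ k) (2 ^ h + 2 ^ l) + E h l / ((a h)\<^sup>2 * (a l)\<^sup>2)\<bar> \<le> 4 / (a h * a l)"
        using top_level_error[OF n dyadic[OF that(1)] dyadic[OF that(2)]]
        by (simp add: D_def E_def a_def add_divide_distrib)
      also have "\<dots> = 4 * 4 ^ k / (2 ^ h * 2 ^ l)" by (simp add: a_def four)
      also have "\<dots> \<le> 4 * 4 ^ k / 1"
        by (intro divide_left_mono) (auto simp flip: power_add)
      finally show ?thesis by simp
    qed
    then have "\<bar>\<Sum>h\<le>k. \<Sum>l\<le>k. coef k h * coef k l * 4 ^ h * 4 ^ l *
          (D (2 ^ k) (2 ^ h + 2 ^ l) + E h l / ((a h)\<^sup>2 * (a l)\<^sup>2))\<bar> \<le> 2 ^ 22 * (4 * 4 ^ k)"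
      by (rule double_sum_coef_le)
    then have top: "\<bar>1 / 4 ^ k * (\<Sum>h\<le>k. \<Sum>l\<le>k. coef k h * coef k l * 4 ^ h * 4 ^ l *
          (D (2 ^ k) (2 ^ h + 2 ^ l) + E h l / ((a h)\<^sup>2 * (a l)\<^sup>2)))\<bar> \<le> 2 ^ 24"
      by (simp add: abs_mult field_simps)
    have T: "\<bar>T j\<bar> \<le> 9 * 2 ^ 33 * 2 ^ k * (1 / 2 ^ j)" if "j < k" for j
    proof -
      have D: "\<bar>D (2 ^ (j + r)) (2 ^ h + 2 ^ l)\<bar> \<le> 9 * 2 ^ k" if "r \<le> k - j" "h \<le> j" "l \<le> j" for r h l
      proof -
        let ?u = "2 ^ (j + r) / 2 ^ k :: real" and ?v = "(2 ^ h + 2 ^ l) / 2 ^ k :: real"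
        have "(2::real) ^ (j + r) \<le> 2 ^ k" using that \<open>j < k\<close> by (intro power_increasing) auto
        then have u: "0 < ?u" "?u \<le> 1" by auto
        have "(2::real) ^ h \<le> 2 ^ j" "(2::real) ^ l \<le> 2 ^ j" "(2::real) ^ Suc j \<le> 2 ^ k"
          using that \<open>j < k\<close> by (auto intro!: power_increasing simp del: power_Suc)
        then have "(2::real) ^ h + 2 ^ l \<le> 2 ^ k" unfolding power_Suc by linarith
        then have v: "0 < ?v" "?v \<le> 1" by (auto simp: add_pos_pos)
        have "1 / ?u \<le> 2 ^ k" by (simp add: mult_left_le field_simps)
        moreover have "1 / ?v \<le> 2 ^ k"
        proof -
          have "(1::real) \<le> 2 ^ h" "(0::real) \<le> 2 ^ l" by auto
          then have "(1::real) \<le> 2 ^ h + 2 ^ l" by linarith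
          then have "2 ^ k * 1 \<le> 2 ^ k * (2 ^ h + 2 ^ l :: real)" by (rule mult_left_mono) simp
          then show ?thesis using v by (simp add: field_simps)
        qed
        ultimately have "7 / ?u + 2 / ?v \<le> 9 * 2 ^ k" by simp
        then show ?thesis
          using phi_discrete_error[OF u v, of n] unfolding D_def by linarith
      qed
      have "\<bar>\<Sum>r\<le>k - j. coef (k - j) r * pair_sum j (D (2 ^ (j + r)))\<bar>
          \<le> (\<Sum>r\<le>k - j. \<bar>coef (k - j) r\<bar> * (2 ^ 22 * (9 * 2 ^ k)))"
      proof (intro order_trans[OF sum_abs] sum_mono)
        fix r assume "r \<in> {..k - j}"
        then have "\<bar>pair_sum j (D (2 ^ (j + r)))\<bar> \<le> 2 ^ 22 * (9 * 2 ^ k)"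
          using D by (intro pair_sum_le) auto
        then show "\<bar>coef (k - j) r * pair_sum j (D (2 ^ (j + r)))\<bar> \<le> \<bar>coef (k - j) r\<bar> * (2 ^ 22 * (9 * 2 ^ k))"
          unfolding abs_mult by (rule mult_left_mono) simp
      qed
      also have "\<dots> \<le> 2048 * (2 ^ 22 * (9 * 2 ^ k))"
        unfolding sum_distrib_right[symmetric] by (intro mult_right_mono sum_abs_coef_le) auto
      finally have "1 / 2 ^ j * \<bar>\<Sum>r\<le>k - j. coef (k - j) r * pair_sum j (D (2 ^ (j + r)))\<bar>
          \<le> 1 / 2 ^ j * (2048 * (2 ^ 22 * (9 * 2 ^ k)))" by (intro mult_left_mono) auto
      then show ?thesis by (simp add: T_def abs_mult)
    qed
    have "\<bar>sum T {..<k}\<bar> \<le> (\<Sum>j<k. 9 * 2 ^ 33 * 2 ^ k * (1 / 2 ^ j))"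
      using T by (intro order_trans[OF sum_abs] sum_mono) auto
    also have "\<dots> \<le> (\<Sum>j\<le>k. 9 * 2 ^ 33 * 2 ^ k * (1 / 2 ^ j))"
      by (rule sum_mono2) auto
    also have "\<dots> \<le> 9 * 2 ^ 33 * 2 ^ k * 2"
      unfolding sum_distrib_left[symmetric] by (intro mult_left_mono sum_inverse_power_2_le) auto
    finally have "\<bar>1 / 2 ^ k * sum T {..<k}\<bar> \<le> 9 * 2 ^ 34"
      by (simp add: abs_mult field_simps)
    then show ?thesis using top by linarith
  qed
  also have "(9 * 2 ^ 34 + 2 ^ 24 :: real) \<le> 2 ^ 38" by simp
  finally show ?thesis .
qed

section \<open>Positivity of G\<close>

text \<open>
  The density of \<open>E\<^sub>0 + E\<^sub>1 / 2 + \<dots> + E\<^sub>m / 2 ^ m\<close>, a hypoexponential distribution. Positivity of \<open>G\<close>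
  needs a lower bound for it that is uniform in \<open>m\<close>.
\<close>

definition hypoexp_density :: "nat \<Rightarrow> real \<Rightarrow> real" where
  "hypoexp_density m y = (\<Sum>r\<le>m. coef m r * exp (- (2 ^ r * y)))"

text \<open>
  The summand \<open>E\<^sub>0\<close> makes the density a convolution with \<open>exp (- y)\<close>, so the factor \<open>exp y\<close> leaves an
  increasing function, whose derivative is given by the density with one summand less.
\<close>

definition tilted_hypoexp :: "nat \<Rightarrow> real \<Rightarrow> real" where
  "tilted_hypoexp m y = exp y * hypoexp_density m y"

lemma tilted_hypoexp_eq:
  "tilted_hypoexp m y = (\<Sum>r\<le>m. coef m r * exp (- ((2 ^ r - 1) * y)))"
  unfolding tilted_hypoexp_def hypoexp_density_def sum_distrib_left
  by (intro sum.cong refl) (simp add: algebra_simps flip: exp_add)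

lemma tilted_hypoexp_0 [simp]: "tilted_hypoexp 0 y = 1"
  by (simp add: tilted_hypoexp_eq)

lemma tilted_hypoexp_Suc_at_0: "tilted_hypoexp (Suc m) 0 = 0"
  using sum_coef[of m] by (simp add: tilted_hypoexp_eq)

lemma tilted_hypoexp_deriv:
  "(tilted_hypoexp (Suc m) has_real_derivative 2 * exp (- y) * tilted_hypoexp m (2 * y)) (at y)"
proof -
  have "((\<lambda>y. \<Sum>r\<le>Suc m. coef (Suc m) r * exp (- ((2 ^ r - 1) * y))) has_real_derivative
      (\<Sum>r\<le>Suc m. coef (Suc m) r * (1 - 2 ^ r) * exp (- ((2 ^ r - 1) * y)))) (at y)"
    by (rule DERIV_sum) (auto intro!: derivative_eq_intros simp: algebra_simps)
  also have "(\<Sum>r\<le>Suc m. coef (Suc m) r * (1 - 2 ^ r) * exp (- ((2 ^ r - 1) * y)))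
      = (\<Sum>r\<le>m. 2 * coef m r * exp (- ((2 ^ Suc r - 1) * y)))"
    by (subst sum.atMost_Suc_shift) (simp add: coef_Suc_Suc del: power_Suc)
  also have "\<dots> = 2 * exp (- y) * tilted_hypoexp m (2 * y)"
    unfolding tilted_hypoexp_eq sum_distrib_left
    by (intro sum.cong refl) (simp add: algebra_simps flip: exp_add)
  finally show ?thesis
    unfolding tilted_hypoexp_eq[abs_def] .
qed

lemma tilted_hypoexp_nonneg_mono:
  shows "0 \<le> y \<Longrightarrow> 0 \<le> tilted_hypoexp m y"
    and "0 \<le> x \<Longrightarrow> x \<le> y \<Longrightarrow> tilted_hypoexp m x \<le> tilted_hypoexp m y"
proof (induction m arbitrary: x y)
  case 0
  { case 1 then show ?case by simp next case 2 then show ?case by simp }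
next
  case (Suc m)
  have mono: "tilted_hypoexp (Suc m) x \<le> tilted_hypoexp (Suc m) y" if "0 \<le> x" "x \<le> y" for x y
  proof (rule DERIV_nonneg_imp_nondecreasing[OF that(2)])
    fix z assume "x \<le> z" "z \<le> y"
    then show "\<exists>d. (tilted_hypoexp (Suc m) has_real_derivative d) (at z) \<and> 0 \<le> d"
    proof (intro exI conjI)
      show "(tilted_hypoexp (Suc m) has_real_derivative 2 * exp (- z) * tilted_hypoexp m (2 * z)) (at z)"
        by (rule tilted_hypoexp_deriv)
      show "0 \<le> 2 * exp (- z) * tilted_hypoexp m (2 * z)"
        using Suc.IH(1)[of "2 * z"] that \<open>x \<le> z\<close> by simp
    qed
  qed
  { case 1 then show ?case using mono[of 0 y] by (simp add: tilted_hypoexp_Suc_at_0)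
  next case 2 then show ?case by (rule mono) }
qed

text \<open>
  A lower bound at \<open>3 / 2 * y\<close> passes down to \<open>y\<close> at the cost of one more summand: the function grows
  between \<open>3 / 4 * y\<close> and \<open>y\<close> at a rate governed by values beyond \<open>3 / 2 * y\<close>.
\<close>

lemma tilted_hypoexp_step:
  assumes "0 < y"
  shows "y / 2 * exp (- y) * tilted_hypoexp m (3 / 2 * y) \<le> tilted_hypoexp (Suc m) y"
proof -
  have "\<exists>z>3 / 4 * y. z < y \<and> tilted_hypoexp (Suc m) y - tilted_hypoexp (Suc m) (3 / 4 * y)
      = (y - 3 / 4 * y) * (2 * exp (- z) * tilted_hypoexp m (2 * z))"
    by (rule MVT2) (use assms tilted_hypoexp_deriv in auto)
  then obtain z where z: "3 / 4 * y < z" "z < y" and eq: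
    "tilted_hypoexp (Suc m) y - tilted_hypoexp (Suc m) (3 / 4 * y) = y / 2 * (exp (- z) * tilted_hypoexp m (2 * z))"
    by auto
  have "exp (- y) * tilted_hypoexp m (3 / 2 * y) \<le> exp (- z) * tilted_hypoexp m (2 * z)"
  proof (rule mult_mono)
    show "tilted_hypoexp m (3 / 2 * y) \<le> tilted_hypoexp m (2 * z)"
      using z assms by (intro tilted_hypoexp_nonneg_mono(2)) auto
    show "0 \<le> tilted_hypoexp m (3 / 2 * y)"
      using assms by (intro tilted_hypoexp_nonneg_mono(1)) auto
  qed (use z in auto)
  then have "y / 2 * (exp (- y) * tilted_hypoexp m (3 / 2 * y)) \<le> y / 2 * (exp (- z) * tilted_hypoexp m (2 * z))"
    using assms by (intro mult_left_mono) auto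
  moreover have "0 \<le> tilted_hypoexp (Suc m) (3 / 4 * y)"
    using assms by (intro tilted_hypoexp_nonneg_mono(1)) auto
  ultimately show ?thesis using eq unfolding mult.assoc by linarith
qed

text \<open>
  For large \<open>y\<close> the term \<open>r = 0\<close> dominates; its coefficient is \<open>1 / Q m \<ge> 1\<close>, and \<open>4096\<close> is twice the
  bound \<open>2048\<close> for the sum of all coefficients.
\<close>

lemma tilted_hypoexp_large:
  assumes "0 < y" "4096 \<le> exp y"
  shows "1 / 2 \<le> tilted_hypoexp m y"
proof (cases m)
  case (Suc n)
  have "\<bar>\<Sum>r\<le>n. coef m (Suc r) * exp (- ((2 ^ Suc r - 1) * y))\<bar> \<le> (\<Sum>r\<le>n. \<bar>coef m (Suc r)\<bar> * exp (- y))"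
  proof (intro order_trans[OF sum_abs] sum_mono)
    fix r
    have "1 * y \<le> (2 ^ Suc r - 1) * y"
      using assms one_le_power[of "2::real" r] by (intro mult_right_mono) auto
    then show "\<bar>coef m (Suc r) * exp (- ((2 ^ Suc r - 1) * y))\<bar> \<le> \<bar>coef m (Suc r)\<bar> * exp (- y)"
      unfolding abs_mult by (intro mult_left_mono) auto
  qed
  also have "\<dots> = (\<Sum>r\<le>n. \<bar>coef m (Suc r)\<bar>) * exp (- y)" by (simp add: sum_distrib_right)
  also have "\<dots> \<le> 2048 * (1 / 4096)"
  proof (rule mult_mono)
    have "(\<Sum>r\<le>n. \<bar>coef m (Suc r)\<bar>) \<le> (\<Sum>r\<le>m. \<bar>coef m r\<bar>)"
      unfolding Suc by (simp add: sum.atMost_Suc_shift del: sum.atMost_Suc)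
    then show "(\<Sum>r\<le>n. \<bar>coef m (Suc r)\<bar>) \<le> 2048" using sum_abs_coef_le[of m] by linarith
    show "exp (- y) \<le> 1 / 4096" using assms by (simp add: exp_minus field_simps)
  qed auto
  finally have "\<bar>\<Sum>r\<le>n. coef m (Suc r) * exp (- ((2 ^ Suc r - 1) * y))\<bar> \<le> 1 / 2" by simp
  moreover have "tilted_hypoexp m y = coef m 0 + (\<Sum>r\<le>n. coef m (Suc r) * exp (- ((2 ^ Suc r - 1) * y)))"
    unfolding tilted_hypoexp_eq Suc by (subst sum.atMost_Suc_shift) simp
  moreover have "1 \<le> coef m 0"
    using Q_le_1[of m] Q_pos[of m] by (simp add: coef_def binomial_eq_0)
  ultimately show ?thesis by linarith
qed simp

text \<open>
  Start from the region where \<open>tilted_hypoexp_large\<close> applies and come down to \<open>y\<close> in finitely many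
  steps by the factor \<open>3 / 2\<close>; their number depends on \<open>y\<close> but not on \<open>m\<close>.
\<close>

lemma tilted_hypoexp_eventually_pos:
  assumes "0 < y"
  shows "\<exists>\<delta>>0. \<exists>N. \<forall>m\<ge>N. \<delta> \<le> tilted_hypoexp m y"
proof -
  have *: "\<exists>\<delta>>0. \<forall>m\<ge>i. \<delta> \<le> tilted_hypoexp m y" if "0 < y" "4096 \<le> exp ((3 / 2) ^ i * y)" for i y
    using that
  proof (induction i arbitrary: y)
    case 0
    then show ?case using tilted_hypoexp_large by (intro exI[of _ "1 / 2"]) auto
  next
    case (Suc i)
    have "(3 / 2) ^ Suc i * y = (3 / 2) ^ i * (3 / 2 * y)" by simp
    then have "4096 \<le> exp ((3 / 2) ^ i * (3 / 2 * y))" using Suc.prems(2) by (simp only:)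
    moreover have "0 < 3 / 2 * y" using Suc.prems(1) by simp
    ultimately obtain \<delta> where \<delta>: "0 < \<delta>" "\<forall>m\<ge>i. \<delta> \<le> tilted_hypoexp m (3 / 2 * y)"
      using Suc.IH by blast
    have "y / 2 * exp (- y) * \<delta> \<le> tilted_hypoexp m y" if m: "Suc i \<le> m" for m
    proof -
      obtain n where n: "m = Suc n" "i \<le> n" using m by (cases m) auto
      have "y / 2 * exp (- y) * \<delta> \<le> y / 2 * exp (- y) * tilted_hypoexp n (3 / 2 * y)"
        using \<delta> n Suc.prems by (intro mult_left_mono) auto
      also have "\<dots> \<le> tilted_hypoexp m y" unfolding n by (rule tilted_hypoexp_step) fact
      finally show ?thesis .
    qed
    then show ?case using \<delta> Suc.prems by (intro exI[of _ "y / 2 * exp (- y) * \<delta>"]) auto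
  qed
  obtain i where "ln 4096 / y < (3 / 2) ^ i" using real_arch_pow[of "3 / 2" "ln 4096 / y"] by auto
  then have "ln 4096 \<le> (3 / 2) ^ i * y" using assms by (simp add: field_simps)
  then have "exp (ln 4096) \<le> exp ((3 / 2) ^ i * y)" by (simp only: exp_le_cancel_iff)
  then have "4096 \<le> exp ((3 / 2) ^ i * y)" by simp
  then show ?thesis using *[OF assms] by blast
qed

text \<open>
  Level \<open>j\<close> of the kernel sum is the integral of a density against \<open>x - t\<close> times the square of a real
  function. This exhibits the signed sum as a nonnegative number.
\<close>

lemma kernel_level_integral:
  "((\<lambda>t. hypoexp_density m (2 ^ j * t) * ((x - t) * (\<Sum>h\<le>j. coef j h * 4 ^ h * exp (- (2 ^ h * (x - t))))\<^sup>2))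
     has_integral (\<Sum>r\<le>m. coef m r * pair_sum j (\<lambda>v. phi (2 ^ (j + r)) v x))) {0..x}"
proof -
  have int: "((\<lambda>t. (x - t) * exp (- (v * (x - t))) * exp (- (u * t))) has_integral phi u v x) {0..x}" for u v
    unfolding phi_convolution
    by (intro integrable_integral integrable_continuous_interval continuous_intros)
  have "((\<lambda>t. \<Sum>r\<le>m. coef m r * (\<Sum>h\<le>j. \<Sum>l\<le>j. coef j h * coef j l * 4 ^ h * 4 ^ l *
          ((x - t) * exp (- ((2 ^ h + 2 ^ l) * (x - t))) * exp (- (2 ^ (j + r) * t)))))
     has_integral (\<Sum>r\<le>m. coef m r * pair_sum j (\<lambda>v. phi (2 ^ (j + r)) v x))) {0..x}"
    unfolding pair_sum_def
    by (intro has_integral_sum has_integral_mult_right int) auto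
  also have "(\<lambda>t. \<Sum>r\<le>m. coef m r * (\<Sum>h\<le>j. \<Sum>l\<le>j. coef j h * coef j l * 4 ^ h * 4 ^ l *
          ((x - t) * exp (- ((2 ^ h + 2 ^ l) * (x - t))) * exp (- (2 ^ (j + r) * t)))))
     = (\<lambda>t. hypoexp_density m (2 ^ j * t) * ((x - t) * (\<Sum>h\<le>j. coef j h * 4 ^ h * exp (- (2 ^ h * (x - t))))\<^sup>2))"
  proof
    fix t
    let ?S = "\<Sum>h\<le>j. coef j h * 4 ^ h * exp (- (2 ^ h * (x - t)))"
    have level: "(\<Sum>h\<le>j. \<Sum>l\<le>j. coef j h * coef j l * 4 ^ h * 4 ^ l *
          ((x - t) * exp (- ((2 ^ h + 2 ^ l) * (x - t))) * e)) = ((x - t) * ?S\<^sup>2) * e" for e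
    proof -
      have split: "exp (- ((a + b) * (x - t))) = exp (- (a * (x - t))) * exp (- (b * (x - t)))" for a b
        by (simp add: algebra_simps flip: exp_add)
      show ?thesis
        unfolding power2_eq_square sum_product sum_distrib_left sum_distrib_right split
        by (intro sum.cong refl) (simp only: mult_ac)
    qed
    show "(\<Sum>r\<le>m. coef m r * (\<Sum>h\<le>j. \<Sum>l\<le>j. coef j h * coef j l * 4 ^ h * 4 ^ l *
          ((x - t) * exp (- ((2 ^ h + 2 ^ l) * (x - t))) * exp (- (2 ^ (j + r) * t)))))
        = hypoexp_density m (2 ^ j * t) * ((x - t) * ?S\<^sup>2)"
      unfolding level hypoexp_density_def sum_distrib_right
      by (intro sum.cong refl) (simp add: power_add mult_ac)
  qed
  finally show ?thesis .
qed

lemma hypoexp_density_nonneg: "0 \<le> y \<Longrightarrow> 0 \<le> hypoexp_density m y"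
  using tilted_hypoexp_nonneg_mono(1)[of y m] by (simp add: tilted_hypoexp_def zero_le_mult_iff)

text \<open>
  All levels are nonnegative, so level \<open>0\<close> alone is a lower bound, and in its integral the piece
  from \<open>x / 2\<close> to \<open>3 / 4 * x\<close>. There both \<open>t\<close> and \<open>x - t\<close> are at least \<open>x / 4\<close>, which bounds every factor below.
\<close>

lemma kernel_sum_phi_lower:
  assumes "0 < x" "0 \<le> \<delta>" "\<delta> \<le> tilted_hypoexp k (x / 2)"
  shows "\<delta> * exp (- (3 * x)) * x\<^sup>2 / 16 \<le> kernel_sum k (\<lambda>u v. phi u v x)"
proof -
  define I where "I j = (\<Sum>r\<le>k - j. coef (k - j) r * pair_sum j (\<lambda>v. phi (2 ^ (j + r)) v x))" for j
  have nonneg: "0 \<le> I j" for j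
    unfolding I_def
    by (rule has_integral_nonneg[OF kernel_level_integral])
      (auto intro!: mult_nonneg_nonneg hypoexp_density_nonneg)
  let ?f = "\<lambda>t. hypoexp_density k t * ((x - t) * (exp (- (x - t)))\<^sup>2)"
  have I0: "(?f has_integral I 0) {0..x}"
    using kernel_level_integral[of k 0 x] by (simp add: I_def)
  have "\<delta> * exp (- (3 * x)) * x\<^sup>2 / 16 = integral {x / 2..3 / 4 * x} (\<lambda>_. \<delta> * exp (- (3 * x)) * (x / 4))"
    using assms by (simp add: power2_eq_square)
  also have "\<dots> \<le> integral {x / 2..3 / 4 * x} ?f"
  proof (rule integral_le)
    show "?f integrable_on {x / 2..3 / 4 * x}"
      unfolding hypoexp_density_def by (intro integrable_continuous_interval continuous_intros)
    fix t assume t: "t \<in> {x / 2..3 / 4 * x}"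
    have "exp (- x) * \<delta> \<le> exp (- t) * tilted_hypoexp k t"
      using t assms tilted_hypoexp_nonneg_mono(2)[of "x / 2" t k]
      by (intro mult_mono) auto
    moreover have "exp (- t) * tilted_hypoexp k t = hypoexp_density k t"
      by (simp add: tilted_hypoexp_def flip: mult.assoc exp_add)
    moreover have "exp (- (2 * x)) \<le> (exp (- (x - t)))\<^sup>2"
      using t assms by (simp add: power2_eq_square flip: exp_add)
    ultimately have le: "(exp (- x) * \<delta>) * ((x / 4) * exp (- (2 * x))) \<le> ?f t"
      using t assms by (intro mult_mono) (auto intro!: hypoexp_density_nonneg)
    have eq: "(exp (- x) * \<delta>) * ((x / 4) * exp (- (2 * x))) = \<delta> * exp (- (3 * x)) * (x / 4)"
    proof -
      have "exp (- (3 * x)) = exp (- x) * exp (- (2 * x))" by (simp flip: exp_add)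
      then show ?thesis by simp
    qed
    from le show "\<delta> * exp (- (3 * x)) * (x / 4) \<le> ?f t" unfolding eq .
  qed auto
  also have "\<dots> \<le> integral {0..x} ?f"
  proof (rule integral_subset_le)
    show "?f integrable_on {x / 2..3 / 4 * x}"
      unfolding hypoexp_density_def by (intro integrable_continuous_interval continuous_intros)
    show "?f integrable_on {0..x}" using I0 by blast
  qed (use assms in \<open>auto intro!: mult_nonneg_nonneg hypoexp_density_nonneg\<close>)
  also have "\<dots> = I 0" using I0 by (rule integral_unique)
  also have "\<dots> \<le> kernel_sum k (\<lambda>u v. phi u v x)"
  proof -
    have "kernel_sum k (\<lambda>u v. phi u v x) = (\<Sum>j\<le>k. 1 / 2 ^ j * I j)"
      by (simp add: kernel_sum_def I_def)
    moreover have "1 / 2 ^ 0 * I 0 \<le> (\<Sum>j\<le>k. 1 / 2 ^ j * I j)"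
      using nonneg by (intro member_le_sum) auto
    ultimately show ?thesis by simp
  qed
  finally show ?thesis .
qed

lemma G_pos:
  assumes "0 < x"
  shows "0 < G x"
proof -
  obtain \<delta> N where \<delta>: "0 < \<delta>" "\<And>m. N \<le> m \<Longrightarrow> \<delta> \<le> tilted_hypoexp m (x / 2)"
    using tilted_hypoexp_eventually_pos[of "x / 2"] assms by auto
  define c where "c = \<delta> * exp (- (3 * x)) * x\<^sup>2 / 16"
  have "c \<le> G x"
  proof (rule tendsto_lowerbound)
    show "((\<lambda>k. G x + 2 ^ 34 * (1 / 2) ^ k) \<longlongrightarrow> G x) sequentially"
      by (auto intro!: tendsto_eq_intros LIMSEQ_power_zero)
    have "c \<le> G x + 2 ^ 34 * (1 / 2) ^ k" if "N \<le> k" for k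
      using kernel_sum_phi_lower[OF assms _ \<delta>(2)[OF that]] kernel_sum_phi_error[of x k] \<delta>(1) assms
      by (simp add: c_def power_one_over abs_le_iff)
    then show "\<forall>\<^sub>F k in sequentially. c \<le> G x + 2 ^ 34 * (1 / 2) ^ k"
      by (auto simp: eventually_sequentially)
  qed simp
  moreover have "0 < c" using \<delta> assms by (simp add: c_def)
  ultimately show ?thesis by linarith
qed

theorem theorem2:
  shows "(\<forall>x>0. G x > 0) \<and>
    (\<exists>C. \<forall>n k. k \<le> n \<longrightarrow>
      \<bar>prob_space.variance (random_records n) (\<lambda>\<omega>. real (external_profile n k \<omega>))
         - 2 ^ k * G (real n / 2 ^ k)\<bar> \<le> C)"
proof
  show "\<forall>x>0. G x > 0" using G_pos by simp
  define err where "err n k = \<bar>second_moment k n - (mean k n)\<^sup>2 - 2 ^ k * G (real n / 2 ^ k)\<bar>" for n k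
  have large: "err n k \<le> 2 ^ 38 + 2 ^ 34" if "2 \<le> n" for n k
  proof -
    let ?K = "kernel_sum k (\<lambda>u v. phi u v (real n / 2 ^ k))"
    have "\<bar>2 ^ k * ?K - 2 ^ k * G (real n / 2 ^ k)\<bar> = 2 ^ k * \<bar>?K - G (real n / 2 ^ k)\<bar>"
      by (simp add: abs_mult flip: right_diff_distrib)
    also have "\<dots> \<le> 2 ^ k * (2 ^ 34 / 2 ^ k)"
      by (intro mult_left_mono kernel_sum_phi_error) auto
    finally have "\<bar>2 ^ k * ?K - 2 ^ k * G (real n / 2 ^ k)\<bar> \<le> 2 ^ 34" by simp
    then show ?thesis
      using second_moment_minus_kernel_sum[OF that, of k] unfolding err_def by linarith
  qed
  \<comment> \<open>the cancellation on the top level needs two records; only three pairs with \<open>k \<le> n < 2\<close> remain\<close>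
  have "err n k \<le> 2 ^ 38 + 2 ^ 34 + err 0 0 + err 1 0 + err 1 1" if "k \<le> n" for n k
  proof (cases "2 \<le> n")
    case True
    have "0 \<le> err 0 0" "0 \<le> err 1 0" "0 \<le> err 1 1" by (simp_all add: err_def)
    then show ?thesis using large[OF True, of k] by linarith
  next
    case False
    then have "(n = 0 \<and> k = 0) \<or> (n = 1 \<and> k = 0) \<or> (n = 1 \<and> k = 1)" using that by linarith
    moreover have "0 \<le> err 0 0" "0 \<le> err 1 0" "0 \<le> err 1 1" by (simp_all add: err_def)
    ultimately show ?thesis by auto
  qed
  then show "\<exists>C. \<forall>n k. k \<le> n \<longrightarrow>
      \<bar>prob_space.variance (random_records n) (\<lambda>\<omega>. real (external_profile n k \<omega>))
         - 2 ^ k * G (real n / 2 ^ k)\<bar> \<le> C"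
    unfolding variance_external_profile err_def by blast
qed

end
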